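(* Let $\lambda\in(0,1/2]$ and $d=\lambda n$. Let $h<n^{1/4}$ be a positive integer, and let $\mathcal{R}\subseteq\binom{[n]}{n/2}$ be a family of sets. Let $A$ be chosen uniformly at random from $\mathcal{M}_{n,d}$. Then $$\mathbb{P}[\mathcal{Q}_{h,\mathcal{R}}^c]\lesssim|\mathcal{R}|\exp(-\Omega_\lambda(n)).$$
   Context: Asymptotic notation: $f\lesssim g$ means $f\le Cg$ for a constant $C$, and $\Omega_\lambda(n)$ denotes a quantity that is at least $c_\lambda n$ for some constant $c_\lambda>0$ depending on $\lambda$. $\mathcal{M}_{n,d}$ is the set of all $n\times n$ matrices with entries in $\{0,1\}$ with every row and column summing to $d$. $\binom{[n]}{n/2}$ is the set of subsets of $[n]=\{1,\dots,n\}$ of size $n/2$ (floors and ceilings are omitted). For $A=(a_{ij})\in\mathcal{M}_{n,d}$ with rows $A_1,\dots,A_n$ and $i,j\in[n]$, the switching set is $S_{i,j}=\{k\in[n]:a_{ik}\ne a_{jk}\}$, and for $S\subseteq[n]$, $\omega_{i,j}(S)=\sum_{k\in S}(a_{ik}-a_{jk})$. Complements of subsets of $[n]$ are taken in $[n]$. Define the following events for $A\in\mathcal{M}_{n,d}$: (P1) $\mathcal{Q}_h$: for any $2h$ distinct rows $A_{i_1},\dots,A_{i_h}$ and $A_{j_1},\dots,A_{j_h}$, $\left|\bigcap_{k=1}^h S_{i_k,j_k}^c\right|\le 2(\lambda^2+(1-\lambda)^2)^h n$. (P2) For $S\subseteq[n]$, $\mathcal{Q}'_S$: for all sets of $4$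 distinct rows $A_{i_1},A_{i_2},A_{j_1},A_{j_2}$, $\min(|S_{i_1,j_1}\cap S_{i_2,j_2}\cap S|,\,|S_{i_1,j_1}\cap S_{i_2,j_2}\cap S^c|)\ge(2\lambda(1-\lambda))^2n/4$. (P3) For $S\subseteq[n]$, $\mathcal{Q}''_S$: for every pair of distinct rows $A_i,A_j$, $|\omega_{i,j}(S)|\le\min\left(\frac{|S\cap S_{i,j}|}{6},\frac{|S^c\cap S_{i,j}|}{6}\right)$. (P4) $\mathcal{Q}_{h,\mathcal{R}}=\mathcal{Q}_h\cap\bigcap_{S\in\mathcal{R}}(\mathcal{Q}'_S\cap\mathcal{Q}''_S)$.
   Formalization: The constant in the exponent may depend on h as well as λ (with h growing like n^{1/4} and λ=1/2, Q_h fails for every A, so a bound uniform in h is false), and the family R is assumed nonempty (for empty R the right side is 0 but the probability can be positive). *)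

theory Defs
  imports "HOL-Probability.Probability" "Jordan_Normal_Form.Matrix"
begin

text \<open>Matrices are the dimension-carrying ones of \<^theory>\<open>Jordan_Normal_Form.Matrix\<close>, whose
  indices start at 0, so the index set \<open>[n]\<close> is \<open>{..<n}\<close> throughout. ``Distinct rows'' means rows
  with distinct indices.\<close>

definition reg_mats :: "nat \<Rightarrow> nat \<Rightarrow> int mat set" where
  "reg_mats n d = {A \<in> carrier_mat n n.
     (\<forall>i<n. \<forall>j<n. A $$ (i, j) \<in> {0, 1}) \<and>
     (\<forall>i<n. (\<Sum>j<n. A $$ (i, j)) = int d) \<and>
     (\<forall>j<n. (\<Sum>i<n. A $$ (i, j)) = int d)}"

definition switch_set :: "int mat \<Rightarrow> nat \<Rightarrow> nat \<Rightarrow> nat set" where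
  "switch_set A i j = {k. k < dim_col A \<and> A $$ (i, k) \<noteq> A $$ (j, k)}"

definition omega :: "int mat \<Rightarrow> nat \<Rightarrow> nat \<Rightarrow> nat set \<Rightarrow> int" where
  "omega A i j S = (\<Sum>k\<in>S. A $$ (i, k) - A $$ (j, k))"

text \<open>The parameter \<open>l\<close> of the events is the density \<open>\<lambda>\<close>; the first event is only meant for
  \<open>h > 0\<close>.\<close>

definition event_Q :: "real \<Rightarrow> nat \<Rightarrow> nat \<Rightarrow> nat \<Rightarrow> int mat set" where
  "event_Q l n d h = {A \<in> reg_mats n d. \<forall>i j :: nat \<Rightarrow> nat.
     i ` {..<h} \<subseteq> {..<n} \<and> j ` {..<h} \<subseteq> {..<n} \<and>
     inj_on i {..<h} \<and> inj_on j {..<h} \<and> i ` {..<h} \<inter> j ` {..<h} = {} \<longrightarrow>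
     real (card (\<Inter>k\<in>{..<h}. {..<n} - switch_set A (i k) (j k)))
       \<le> 2 * (l\<^sup>2 + (1 - l)\<^sup>2) ^ h * real n}"

definition event_Q' :: "real \<Rightarrow> nat \<Rightarrow> nat \<Rightarrow> nat set \<Rightarrow> int mat set" where
  "event_Q' l n d S = {A \<in> reg_mats n d. \<forall>i1<n. \<forall>i2<n. \<forall>j1<n. \<forall>j2<n.
     distinct [i1, i2, j1, j2] \<longrightarrow>
     real (min (card (switch_set A i1 j1 \<inter> switch_set A i2 j2 \<inter> S))
               (card (switch_set A i1 j1 \<inter> switch_set A i2 j2 \<inter> ({..<n} - S))))
       \<ge> (2 * l * (1 - l))\<^sup>2 * real n / 4}"

definition event_Q'' :: "nat \<Rightarrow> nat \<Rightarrow> nat set \<Rightarrow> int mat set" where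
  "event_Q'' n d S = {A \<in> reg_mats n d. \<forall>i<n. \<forall>j<n. i \<noteq> j \<longrightarrow>
     real_of_int \<bar>omega A i j S\<bar>
       \<le> min (real (card (S \<inter> switch_set A i j)) / 6)
             (real (card (({..<n} - S) \<inter> switch_set A i j)) / 6)}"

definition event_QR :: "real \<Rightarrow> nat \<Rightarrow> nat \<Rightarrow> nat \<Rightarrow> nat set set \<Rightarrow> int mat set" where
  "event_QR l n d h R = event_Q l n d h \<inter> (\<Inter>S\<in>R. event_Q' l n d S \<inter> event_Q'' n d S)"

end

theory Submission
  imports Defs "HOL-Real_Asymp.Real_Asymp"
begin

text \<open>Each event concerns a bounded number \<open>k\<close> of rows, so it suffices to show that any \<open>k\<close> rows
  of a random regular matrix have, up to a constant factor, the law of \<open>k\<close> independent uniform rows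
  of weight \<open>d\<close>. Given these rows, the number of completions is the number \<open>N(s)\<close> of
  \<open>(n - k) \<times> n\<close> matrices with row sums \<open>d\<close> and column sums \<open>s\<close> in \<open>[d - k, d]\<close>. Moving one unit
  between two entries of \<open>s\<close> changes \<open>N(s)\<close> only by a factor \<open>1 + O(k/d)\<close>: double counting the moves
  expresses the change through the inverse moment of \<open>s\<^sub>p - e\<close>, where \<open>e\<close> is the overlap of
  the two columns, and a switching argument bounds this moment by \<open>O(1/d)\<close>. Any two
  admissible \<open>s\<close> are at most \<open>kn\<close> such moves apart, so all values \<open>N(s)\<close> agree up to the factor
  \<open>exp(O(k\<^sup>2 n/d))\<close>, which is constant. Independent uniform rows of weight \<open>\<lambda>n\<close> are in turn
  dominated, up to a factor \<open>(n + 1)\<^sup>k\<close>, by independent Bernoulli entries, for which the columns are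
  independent and a Chernoff bound applies to every event. A union bound finishes the proof; small
  \<open>n\<close> are absorbed by decreasing \<open>c\<close>.\<close>

subsection \<open>0/1 matrices with prescribed margins\<close>

text \<open>A 0/1 matrix is encoded as the set of positions of its ones, so rows and columns become
  sets and the overlap of two columns is an intersection.\<close>

definition row_set :: "('a \<times> 'b) set \<Rightarrow> 'a \<Rightarrow> 'b set" where "row_set A i = {j. (i, j) \<in> A}"
definition col_set :: "('a \<times> 'b) set \<Rightarrow> 'b \<Rightarrow> 'a set" where "col_set A j = {i. (i, j) \<in> A}"

text \<open>These are the bipartite graphs on the vertex classes \<open>R\<close> and
  \<open>C\<close> with degree functions \<open>r\<close> and \<open>s\<close>.\<close>

definition bip :: "'a set \<Rightarrow> 'b set \<Rightarrow> ('a \<Rightarrow> nat) \<Rightarrow> ('b \<Rightarrow> nat) \<Rightarrow> ('a \<times> 'b) set set" where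
  "bip R C r s = {A. A \<subseteq> R \<times> C \<and> (\<forall>i\<in>R. card (row_set A i) = r i) \<and> (\<forall>j\<in>C. card (col_set A j) = s j)}"

lemma finite_bip: "finite R \<Longrightarrow> finite C \<Longrightarrow> finite (bip R C r s)"
  by (rule finite_subset[of _ "Pow (R \<times> C)"]) (auto simp: bip_def)

lemma bipD:
  assumes "A \<in> bip R C r s"
  shows "A \<subseteq> R \<times> C" "i \<in> R \<Longrightarrow> card (row_set A i) = r i" "j \<in> C \<Longrightarrow> card (col_set A j) = s j"
    "row_set A i \<subseteq> C" "col_set A j \<subseteq> R"
  using assms by (auto simp: bip_def row_set_def col_set_def)

lemma bip_cong:
  "(\<And>i. i \<in> R \<Longrightarrow> r i = r' i) \<Longrightarrow> (\<And>j. j \<in> C \<Longrightarrow> s j = s' j) \<Longrightarrow> bip R C r s = bip R C r' s'"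
  by (auto simp: bip_def)

lemma card_swap: "finite X \<Longrightarrow> v \<in> X \<Longrightarrow> u \<notin> X \<Longrightarrow> card (insert u (X - {v})) = card X"
  by (metis DiffD1 card.remove card_insert_disjoint finite_Diff)

text \<open>Row \<open>i\<close> meets exactly one of the two columns both before and after the
  move, so it never belongs to their overlap, which is therefore invariant.\<close>

lemma move_in_bip:
  assumes fin: "finite R" "finite C" and A: "A \<in> bip R C r s"
    and pq: "p \<in> C" "q \<in> C" and i: "(i, p) \<in> A" "(i, q) \<notin> A"
  defines "A' \<equiv> insert (i, q) (A - {(i, p)})"
  shows "A' \<in> bip R C r (s(p := s p - 1, q := s q + 1))"
    "col_set A' p \<inter> col_set A' q = col_set A p \<inter> col_set A q"
proof -
  have "p \<noteq> q" using i by auto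
  note D = bipD[OF A]
  have iR: "i \<in> R" using D(1) i by auto
  have fr: "finite (row_set A x)" "finite (col_set A y)" for x y
    using D(4,5) fin finite_subset by metis+
  have r: "row_set A' x = (if x = i then insert q (row_set A i - {p}) else row_set A x)" for x
    by (auto simp: A'_def row_set_def)
  have c: "col_set A' x = (if x = q then insert i (col_set A q) else if x = p then col_set A p - {i} else col_set A x)" for x
    using \<open>p \<noteq> q\<close> by (auto simp: A'_def col_set_def)
  have ins: "i \<in> col_set A p" "i \<notin> col_set A q" "p \<in> row_set A i" "q \<notin> row_set A i"
    using i by (auto simp: col_set_def row_set_def)
  have "card (insert q (row_set A i - {p})) = card (row_set A i)"
    using card_swap[OF fr(1)] ins by metis
  then have R: "card (row_set A' x) = r x" if "x \<in> R" for x
    using that D(2) by (auto simp: r)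
  have Cc: "card (col_set A' x) = (s(p := s p - 1, q := s q + 1)) x" if "x \<in> C" for x
    using that D(3)[of x] ins fr(2) \<open>p \<noteq> q\<close> by (auto simp: c card_Diff_singleton)
  have "A' \<subseteq> R \<times> C" using D(1) iR pq by (auto simp: A'_def)
  then show "A' \<in> bip R C r (s(p := s p - 1, q := s q + 1))"
    using R Cc by (simp add: bip_def)
  show "col_set A' p \<inter> col_set A' q = col_set A p \<inter> col_set A q"
    using ins \<open>p \<noteq> q\<close> by (auto simp: c)
qed

text \<open>Double counting of the moves of a single entry from column \<open>p\<close> to column \<open>q\<close>, which do not
  change the overlap of the two columns.\<close>

lemma card_bip_move:
  assumes fin: "finite R" "finite C" and pq: "p \<in> C" "q \<in> C" "p \<noteq> q" and ab: "s q < s p"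
  shows "real (card (bip R C r s)) =
    (\<Sum>A\<in>bip R C r (s(p := s p - 1, q := s q + 1)).
      (real (s q) + 1 - card (col_set A p \<inter> col_set A q)) / (real (s p) - card (col_set A p \<inter> col_set A q)))"
proof -
  define s' where "s' = s(p := s p - 1, q := s q + 1)"
  define e where "e A = real (card (col_set A p \<inter> col_set A q))" for A :: "('a \<times> 'b) set"
  \<comment> \<open>\<open>s q < s p\<close> forces \<open>s p > 0\<close>, so the truncated
    subtraction is exact and the reverse move restores \<open>s\<close>.\<close>
  have rev: "s' (q := s' q - 1, p := s' p + 1) = s" using ab pq by (auto simp: s'_def fun_eq_iff)
  have f1: "finite (col_set A j)" if "A \<in> bip R C r t" for A j t
    using bipD(5)[OF that] fin finite_subset by metis
  have d: "real (card (col_set A x - col_set A y)) = real (t x) - real (card (col_set A x \<inter> col_set A y))"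
    if "A \<in> bip R C r t" "x \<in> C" for A x y t
  proof -
    have "card (col_set A x \<inter> col_set A y) \<le> card (col_set A x)" using f1[OF that(1)] by (auto intro: card_mono)
    then show ?thesis using f1[OF that(1)] bipD(3)[OF that] by (simp add: card_Diff_subset_Int of_nat_diff)
  qed
  \<comment> \<open>Each matrix spreads a unit weight evenly over its \<open>s p - e\<close> movable
    rows; there is at least one because \<open>e \<le> s q < s p\<close>.\<close>
  have "real (card (bip R C r s)) = (\<Sum>A\<in>bip R C r s. \<Sum>i\<in>col_set A p - col_set A q. 1 / (real (s p) - e A))"
  proof -
    have "(\<Sum>i\<in>col_set A p - col_set A q. 1 / (real (s p) - e A)) = 1" if A: "A \<in> bip R C r s" for A
    proof -
      have "card (col_set A p \<inter> col_set A q) \<le> card (col_set A q)" using f1[OF A] by (auto intro: card_mono)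
      then have "e A < real (s p)" using ab bipD(3)[OF A pq(2)] by (simp add: e_def)
      then show ?thesis using d[OF A pq(1), of q] by (simp add: e_def)
    qed
    then have "(\<Sum>A\<in>bip R C r s. \<Sum>i\<in>col_set A p - col_set A q. 1 / (real (s p) - e A)) = (\<Sum>A\<in>bip R C r s. 1)"
      by (rule sum.cong[OF refl])
    then show ?thesis by simp
  qed
  also have "\<dots> = (\<Sum>(A, i)\<in>(SIGMA A:bip R C r s. col_set A p - col_set A q). 1 / (real (s p) - e A))"
    by (rule sum.Sigma) (use finite_bip[OF fin] f1 in auto)
  also have "\<dots> = (\<Sum>(A, i)\<in>(SIGMA A:bip R C r s'. col_set A q - col_set A p). 1 / (real (s p) - e A))"
  proof (rule sum.reindex_bij_witness[where j = "\<lambda>(A, i). (insert (i, q) (A - {(i, p)}), i)"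
        and i = "\<lambda>(A, i). (insert (i, p) (A - {(i, q)}), i)"], goal_cases)
    case (1 x) then show ?case by (auto simp: col_set_def)
  next
    case (2 x)
    then obtain A i where "x = (A, i)" "A \<in> bip R C r s" "(i, p) \<in> A" "(i, q) \<notin> A" by (auto simp: col_set_def)
    with move_in_bip[OF fin this(2) pq(1,2) this(3,4)] pq show ?case by (auto simp: s'_def col_set_def)
  next
    case (3 x) then show ?case by (auto simp: col_set_def)
  next
    case (4 x)
    then obtain A i where "x = (A, i)" "A \<in> bip R C r s'" "(i, q) \<in> A" "(i, p) \<notin> A" by (auto simp: col_set_def)
    with move_in_bip[OF fin this(2) pq(2,1) this(3,4)] pq show ?case unfolding rev by (auto simp: col_set_def)
  next
    case (5 x)
    then obtain A i where "x = (A, i)" "A \<in> bip R C r s" "(i, p) \<in> A" "(i, q) \<notin> A" by (auto simp: col_set_def)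
    with move_in_bip(2)[OF fin this(2) pq(1,2) this(3,4)] show ?case by (auto simp: e_def)
  qed
  also have "\<dots> = (\<Sum>A\<in>bip R C r s'. \<Sum>i\<in>col_set A q - col_set A p. 1 / (real (s p) - e A))"
    by (rule sum.Sigma[symmetric]) (use finite_bip[OF fin] f1 in auto)
  \<comment> \<open>Seen from the other side, column \<open>q\<close> has \<open>s q + 1\<close>
    ones, so there are \<open>s q + 1 - e\<close> reverse moves, each of weight
    \<open>1 / (s p - e)\<close>.\<close>
  also have "\<dots> = (\<Sum>A\<in>bip R C r s'. (real (s q) + 1 - e A) / (real (s p) - e A))"
  proof (rule sum.cong[OF refl])
    fix A assume A: "A \<in> bip R C r s'"
    show "(\<Sum>i\<in>col_set A q - col_set A p. 1 / (real (s p) - e A)) = (real (s q) + 1 - e A) / (real (s p) - e A)"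
      using d[OF A pq(2), of p] pq by (simp add: e_def s'_def Int_commute)
  qed
  finally show ?thesis by (simp add: s'_def e_def)
qed

section \<open>Switchings and the overlap of two columns\<close>

lemma switch_in_bip:
  assumes fin: "finite R" "finite C" and A: "A \<in> bip R C r s"
    and q: "(i, q) \<in> A" "(i', q) \<notin> A" and j: "(i, j) \<notin> A" "(i', j) \<in> A"
  defines "A' \<equiv> A - {(i, q), (i', j)} \<union> {(i', q), (i, j)}"
  shows "A' \<in> bip R C r s"
proof -
  note D = bipD[OF A]
  have fr: "finite (row_set A x)" "finite (col_set A y)" for x y
    using D(4,5) fin finite_subset by metis+
  have ne: "i \<noteq> i'" "q \<noteq> j" using q j by auto
  have r: "row_set A' x = (if x = i then insert j (row_set A i - {q}) else
      if x = i' then insert q (row_set A i' - {j}) else row_set A x)" for x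
    using ne by (auto simp: A'_def row_set_def)
  have c: "col_set A' x = (if x = q then insert i' (col_set A q - {i}) else
      if x = j then insert i (col_set A j - {i'}) else col_set A x)" for x
    using ne by (auto simp: A'_def col_set_def)
  have "A' \<subseteq> R \<times> C" using D(1) q j by (auto simp: A'_def)
  moreover have "card (row_set A' x) = r x" if "x \<in> R" for x
  proof -
    have "card (insert j (row_set A i - {q})) = card (row_set A i)"
      by (rule card_swap[OF fr(1)]) (use q j in \<open>auto simp: row_set_def\<close>)
    moreover have "card (insert q (row_set A i' - {j})) = card (row_set A i')"
      by (rule card_swap[OF fr(1)]) (use q j in \<open>auto simp: row_set_def\<close>)
    ultimately show ?thesis using D(2)[OF that] by (auto simp: r)
  qed
  moreover have "card (col_set A' x) = s x" if "x \<in> C" for x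
  proof -
    have "card (insert i' (col_set A q - {i})) = card (col_set A q)"
      by (rule card_swap[OF fr(2)]) (use q in \<open>auto simp: col_set_def\<close>)
    moreover have "card (insert i (col_set A j - {i'})) = card (col_set A j)"
      by (rule card_swap[OF fr(2)]) (use j in \<open>auto simp: col_set_def\<close>)
    ultimately show ?thesis using D(3)[OF that] by (auto simp: c)
  qed
  ultimately show ?thesis by (simp add: bip_def)
qed

text \<open>Double counting of the switching \<open>(i, q), (i', j) \<mapsto> (i', q), (i, j)\<close>, where row \<open>i\<close> meets both
  columns \<open>p, q\<close> and row \<open>i'\<close> meets neither. With \<open>y\<close> the size of the difference of the two
  rows, there are \<open>y\<close> choices of \<open>j\<close> forwards but only \<open>y - 1\<close> backwards; this is where equality of
  the row sums enters. The weight is chosen to cancel the number of reverse pairs \<open>(i, i')\<close>.\<close>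

lemma overlap_moment:
  assumes fin: "finite R" "finite C" and pq: "p \<in> C" "q \<in> C" "p \<noteq> q"
  shows "(\<Sum>A\<in>bip R C (\<lambda>_. d) s.
      real (card (col_set A p \<inter> col_set A q)) * real (card (R - (col_set A p \<union> col_set A q)))
      / ((real (s p) + 1 - card (col_set A p \<inter> col_set A q)) * (real (s q) + 1 - card (col_set A p \<inter> col_set A q))))
    \<le> real (card (bip R C (\<lambda>_. d) s))"
proof -
  define M where "M = bip R C (\<lambda>_. d) s"
  define e where "e A = real (card (col_set A p \<inter> col_set A q))" for A :: "('a \<times> 'b) set"
  define g where "g x = 1 / ((real (s p) + 1 - x) * (real (s q) + 1 - x))" for x
  define y where "y A i i' = real (card (row_set A i - row_set A i'))" for A :: "('a \<times> 'b) set" and i i'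
  let ?P = "\<lambda>A. col_set A p" and ?Q = "\<lambda>A. col_set A q"
  define N where "N A = R - (?P A \<union> ?Q A)" for A
  have fM: "finite M" using finite_bip[OF fin] by (simp add: M_def)
  have AM: "A \<subseteq> R \<times> C" if "A \<in> M" for A using bipD(1)[OF that[unfolded M_def]] .
  have fc: "finite (col_set A j)" "finite (row_set A i)" if "A \<in> M" for A i j
    using bipD(4,5) that fin finite_subset unfolding M_def by metis+
  have fN: "finite (N A)" for A using fin by (simp add: N_def)
  have inR: "i \<in> R" "j \<in> C" if "A \<in> M" "(i, j) \<in> A" for A i j using AM[OF that(1)] that(2) by auto
  have ysym: "real (card (row_set A i' - row_set A i)) = y A i i'" if "A \<in> M" "i \<in> R" "i' \<in> R" for A i i'
  proof -
    have "card (row_set A i) = card (row_set A i')" using that bipD(2) unfolding M_def by metis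
    then have "card (row_set A i' - row_set A i) = card (row_set A i - row_set A i')"
      using fc[OF that(1)] by (metis card_Diff_subset_Int Int_commute finite_Int)
    then show ?thesis by (simp add: y_def)
  qed
  define f where "f = (\<lambda>(A, i, i', j). (A - {(i, q), (i', j)} \<union> {(i', q), (i, j)} :: ('a \<times> 'b) set, i, i', j))"
  define b where "b = (\<lambda>(A, i, i', j). (A - {(i', q), (i, j)} \<union> {(i, q), (i', j)} :: ('a \<times> 'b) set, i, i', j))"
  \<comment> \<open>\<open>X\<close> lists the forward switchings and \<open>Y\<close> the reverse
    ones. The column \<open>p\<close> is excluded from \<open>Y\<close> because row
    \<open>i'\<close> misses it before a forward switching, so \<open>j\<close> cannot be
    \<open>p\<close>.\<close>
  define X where "X = (SIGMA A:M. SIGMA i:?P A \<inter> ?Q A. SIGMA i':N A. row_set A i' - row_set A i)"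
  define Y where "Y = (SIGMA A:M. SIGMA i:?P A - ?Q A. SIGMA i':?Q A - ?P A. row_set A i - row_set A i' - {p})"

  \<comment> \<open>The weight of a pair of rows is split over the \<open>y\<close> columns
    available for \<open>j\<close>; \<open>y > 0\<close> since column \<open>p\<close> separates the
    two rows.\<close>
  have "(\<Sum>A\<in>M. e A * card (N A) * g (e A)) =
      (\<Sum>A\<in>M. \<Sum>i\<in>?P A \<inter> ?Q A. \<Sum>i'\<in>N A. \<Sum>j\<in>row_set A i' - row_set A i. g (e A) / y A i i')"
  proof (rule sum.cong[OF refl])
    fix A assume A: "A \<in> M"
    have "(\<Sum>j\<in>row_set A i' - row_set A i. g (e A) / y A i i') = g (e A)"
      if i: "i \<in> ?P A \<inter> ?Q A" "i' \<in> N A" for i i'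
    proof -
      have i2: "i \<in> R" "i' \<in> R" using i inR[OF A] by (auto simp: N_def col_set_def)
      have "p \<in> row_set A i - row_set A i'" using i by (auto simp: row_set_def col_set_def N_def)
      then have "y A i i' > 0" using fc[OF A] by (auto simp: y_def card_gt_0_iff)
      then show ?thesis using ysym[OF A i2] by simp
    qed
    then have "(\<Sum>i\<in>?P A \<inter> ?Q A. \<Sum>i'\<in>N A. \<Sum>j\<in>row_set A i' - row_set A i. g (e A) / y A i i')
      = (\<Sum>i\<in>?P A \<inter> ?Q A. \<Sum>i'\<in>N A. g (e A))"
      by (intro sum.cong refl) auto
    then show "e A * card (N A) * g (e A) = (\<Sum>i\<in>?P A \<inter> ?Q A. \<Sum>i'\<in>N A. \<Sum>j\<in>row_set A i' - row_set A i. g (e A) / y A i i')"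
      by (simp add: e_def)
  qed
  also have "\<dots> = (\<Sum>(A, i, i', j)\<in>X. g (e A) / y A i i')"
    unfolding X_def using fM fc fN by (simp add: sum.Sigma finite_SigmaI del: sum_constant)
  \<comment> \<open>Row \<open>i\<close> leaves the overlap, which therefore drops by one, while in
    the difference of the two rows \<open>q\<close> is exchanged for \<open>j\<close>, so
    \<open>y\<close> stays the same.\<close>
  also have "\<dots> = (\<Sum>(A, i, i', j)\<in>Y. g (e A + 1) / y A i i')"
  proof (rule sum.reindex_bij_witness[where i = b and j = f], goal_cases)
    case (1 x)
    then show ?case by (auto simp: X_def f_def b_def N_def col_set_def row_set_def)
  next
    case (2 x)
    then obtain A i i' j where x: "x = (A, i, i', j)" and A: "A \<in> M" and
      h: "(i, p) \<in> A" "(i, q) \<in> A" "(i', p) \<notin> A" "(i', q) \<notin> A" "i' \<in> R" "(i', j) \<in> A" "(i, j) \<notin> A"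
      by (auto simp: X_def N_def col_set_def row_set_def)
    have "A - {(i, q), (i', j)} \<union> {(i', q), (i, j)} \<in> M"
      using switch_in_bip[OF fin A[unfolded M_def] h(2,4,7,6)] by (simp add: M_def)
    then show ?case using h pq by (auto simp: x f_def Y_def col_set_def row_set_def)
  next
    case (3 x)
    then show ?case by (auto simp: Y_def f_def b_def N_def col_set_def row_set_def)
  next
    case (4 x)
    then obtain A i i' j where x: "x = (A, i, i', j)" and A: "A \<in> M" and
      h: "(i, p) \<in> A" "(i, q) \<notin> A" "(i', p) \<notin> A" "(i', q) \<in> A" "(i', j) \<notin> A" "(i, j) \<in> A" "j \<noteq> p"
      by (auto simp: Y_def col_set_def row_set_def)
    have "A - {(i', q), (i, j)} \<union> {(i, q), (i', j)} \<in> M"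
      using switch_in_bip[OF fin A[unfolded M_def] h(4,2,5,6)] by (simp add: M_def)
    then show ?case using h pq inR(1)[OF A h(4)] by (auto simp: x b_def X_def col_set_def row_set_def N_def)
  next
    case (5 x)
    then obtain A i i' j where x: "x = (A, i, i', j)" and A: "A \<in> M" and
      h: "(i, p) \<in> A" "(i, q) \<in> A" "(i', p) \<notin> A" "(i', q) \<notin> A" "i' \<in> R" "(i', j) \<in> A" "(i, j) \<notin> A"
      by (auto simp: X_def N_def col_set_def row_set_def)
    let ?A = "A - {(i, q), (i', j)} \<union> {(i', q), (i, j)}"
    have ne: "i \<noteq> i'" "j \<noteq> q" "j \<noteq> p" using h by auto
    have "col_set ?A p \<inter> col_set ?A q = (col_set A p \<inter> col_set A q) - {i}"
      using h ne pq by (auto simp: col_set_def)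
    moreover have "i \<in> col_set A p \<inter> col_set A q" using h by (auto simp: col_set_def)
    ultimately have "e ?A + 1 = e A" using fc[OF A]
      by (simp add: e_def card_Diff_singleton card_gt_0_iff) (metis (no_types, lifting) IntI One_nat_def
          Suc_pred add.commute card_gt_0_iff empty_iff finite_Int of_nat_Suc)
    moreover have "row_set ?A i - row_set ?A i' = insert j (row_set A i - row_set A i' - {q})"
      using h ne by (auto simp: row_set_def)
    then have "y ?A i i' = y A i i'"
      unfolding y_def using card_swap[of "row_set A i - row_set A i'" q j] fc[OF A] h by (simp add: row_set_def)
    ultimately show ?case by (simp add: x f_def)
  qed
  also have "\<dots> = (\<Sum>A\<in>M. \<Sum>i\<in>?P A - ?Q A. \<Sum>i'\<in>?Q A - ?P A. \<Sum>j\<in>row_set A i - row_set A i' - {p}. g (e A + 1) / y A i i')"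
    unfolding Y_def using fM fc fN by (simp add: sum.Sigma finite_SigmaI del: sum_constant)
  also have "\<dots> \<le> (\<Sum>A\<in>M. 1)"
  proof (rule sum_mono)
    fix A assume A: "A \<in> M"
    have d: "real (card (col_set A x - col_set A z)) = real (s x) - real (card (col_set A x \<inter> col_set A z))"
      if "x \<in> C" for x z
    proof -
      have "card (col_set A x \<inter> col_set A z) \<le> card (col_set A x)" using fc[OF A] by (auto intro: card_mono)
      then show ?thesis using fc[OF A] bipD(3)[OF A[unfolded M_def] that]
        by (simp add: card_Diff_subset_Int of_nat_diff)
    qed
    \<comment> \<open>\<open>g (e A + 1)\<close> is the reciprocal of the number of pairs
      \<open>(i, i')\<close> in the reverse count, so these pairs weigh at most 1 in total; with no
      such pair the sum is empty.\<close>
    have g: "g (e A + 1) = 1 / (real (card (?P A - ?Q A)) * real (card (?Q A - ?P A)))"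
      using d[OF pq(1), of q] d[OF pq(2), of p] by (simp add: g_def e_def Int_commute)
    have "(\<Sum>i\<in>?P A - ?Q A. \<Sum>i'\<in>?Q A - ?P A. \<Sum>j\<in>row_set A i - row_set A i' - {p}. g (e A + 1) / y A i i')
       \<le> (\<Sum>i\<in>?P A - ?Q A. \<Sum>i'\<in>?Q A - ?P A. g (e A + 1))"
    proof (intro sum_mono)
      fix i i'
      have "real (card (row_set A i - row_set A i' - {p})) \<le> y A i i'"
        unfolding y_def using fc[OF A] by (auto intro!: card_mono)
      then have "real (card (row_set A i - row_set A i' - {p})) / y A i i' * g (e A + 1) \<le> 1 * g (e A + 1)"
        by (intro mult_right_mono) (auto simp: divide_le_eq_1 y_def g)
      then show "(\<Sum>j\<in>row_set A i - row_set A i' - {p}. g (e A + 1) / y A i i') \<le> g (e A + 1)"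
        by (simp add: mult_ac)
    qed
    also have "\<dots> \<le> 1" by (simp add: g)
    finally show "(\<Sum>i\<in>?P A - ?Q A. \<Sum>i'\<in>?Q A - ?P A. \<Sum>j\<in>row_set A i - row_set A i' - {p}. g (e A + 1) / y A i i') \<le> 1" .
  qed
  finally show ?thesis by (simp add: M_def e_def g_def N_def)
qed

section \<open>Sensitivity of the count to the column sums\<close>

lemma card_bip_balance_ge:
  assumes fin: "finite R" "finite C" and pq: "p \<in> C" "q \<in> C" "p \<noteq> q" and ab: "s q < s p"
  shows "card (bip R C r s) \<le> card (bip R C r (s(p := s p - 1, q := s q + 1)))"
proof -
  let ?s = "s(p := s p - 1, q := s q + 1)" and ?e = "\<lambda>A. card (col_set A p \<inter> col_set A q)"
  \<comment> \<open>As \<open>s q + 1 \<le> s p\<close>, no ratio in the double count exceeds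
    1.\<close>
  have "(real (s q) + 1 - ?e A) / (real (s p) - ?e A) \<le> 1" if A: "A \<in> bip R C r ?s" for A
  proof -
    have "finite (col_set A p)" using bipD(5)[OF A] fin finite_subset by metis
    then have "?e A \<le> card (col_set A p)" by (auto intro: card_mono)
    then have "?e A < s p" using bipD(3)[OF A pq(1)] pq ab by auto
    then show ?thesis using ab by (simp add: divide_le_eq_1)
  qed
  then have "(\<Sum>A\<in>bip R C r ?s. (real (s q) + 1 - ?e A) / (real (s p) - ?e A)) \<le> (\<Sum>A\<in>bip R C r ?s. 1)"
    by (rule sum_mono)
  then show ?thesis using card_bip_move[OF fin pq ab, of r] by simp
qed

text \<open>The inverse is large only when column \<open>p\<close> is almost contained in column
  \<open>q\<close>. A large overlap leaves many rows missing both columns, so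
  \<open>overlap_moment\<close> controls these matrices; for a small overlap the inverse is already
  \<open>O(1/d)\<close>.\<close>

lemma sum_inverse_overlap_le:
  assumes fin: "finite R" "finite C" and pq: "p \<in> C" "q \<in> C" "p \<noteq> q"
    and R: "2 * d \<le> card R + k" and d: "4 * k \<le> d" "0 < d"
    and a: "d \<le> s p + k" "s p < d" and b: "d \<le> s q + k" "s q \<le> d" and ba: "s q \<le> s p + 1"
  shows "(\<Sum>A\<in>bip R C (\<lambda>_. d) s. 1 / (real (s p) + 1 - card (col_set A p \<inter> col_set A q)))
    \<le> 25 / d * card (bip R C (\<lambda>_. d) s)"
proof -
  let ?M = "bip R C (\<lambda>_. d) s"
  define e where "e A = real (card (col_set A p \<inter> col_set A q))" for A :: "('a \<times> 'b) set"
  define m where "m A = real (card (R - (col_set A p \<union> col_set A q)))" for A :: "('a \<times> 'b) set"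
  define u where "u A = real (s p) + 1 - e A" for A
  define v where "v A = real (s q) + 1 - e A" for A
  have dr: "real d > 0" "4 * real k \<le> real d" using d by auto
  have pt: "1 / u A \<le> 8 / d * (e A * m A / (u A * v A)) + 33 / (2 * d)" if A: "A \<in> ?M" for A
  proof -
    have f: "finite (col_set A j)" for j using bipD(5)[OF A] fin finite_subset by metis
    have sub: "col_set A p \<union> col_set A q \<subseteq> R" using bipD(5)[OF A] by blast
    have "card (col_set A p \<inter> col_set A q) \<le> card (col_set A p)" "card (col_set A p \<inter> col_set A q) \<le> card (col_set A q)"
      using f by (auto intro: card_mono)
    then have e: "e A \<le> s p" "e A \<le> s q" using bipD(3)[OF A] pq by (auto simp: e_def)
    have "card (col_set A p \<union> col_set A q) + card (col_set A p \<inter> col_set A q) = s p + s q"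
      using card_Un_Int[OF f f, of p q] bipD(3)[OF A] pq by simp
    moreover have "card (R - (col_set A p \<union> col_set A q)) + card (col_set A p \<union> col_set A q) = card R"
      using card_Diff_subset[OF _ sub] card_mono[OF fin(1) sub] f by simp
    ultimately have m: "m A = real (card R) - s p - s q + e A" by (simp add: m_def e_def)
    have uv: "1 \<le> u A" "1 \<le> v A" "v A \<le> 2 * u A" using e ba by (auto simp: u_def v_def)
    have m0: "0 \<le> m A" "0 \<le> e A" by (auto simp: m_def e_def)
    \<comment> \<open>If \<open>e \<ge> d / 2\<close>, then \<open>m \<ge> e - k \<ge> d / 4\<close>
      and \<open>8 * e * m \<ge> d^2\<close>; otherwise both \<open>u\<close> and \<open>v\<close>
      are at least \<open>d / 4\<close>.\<close>
    have "1 / (u A * v A) \<le> 8 / d^2 * (e A * m A / (u A * v A)) + 16 / d^2"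
    proof (cases "e A \<ge> d / 2")
      case True
      have "d / 4 \<le> m A" using m R a b dr True by linarith
      then have "(d / 2) * (d / 4) \<le> e A * m A" using True dr m0 by (intro mult_mono) auto
      then have "1 \<le> 8 / d^2 * (e A * m A)" using dr by (simp add: field_simps power2_eq_square)
      then have "1 / (u A * v A) \<le> 8 / d^2 * (e A * m A) / (u A * v A)"
        using uv by (intro divide_right_mono) auto
      then show ?thesis by (simp add: add_increasing2)
    next
      case False
      then have "d / 4 \<le> u A" "d / 4 \<le> v A" using a b dr by (simp_all add: u_def v_def)
      then have "(d / 4) * (d / 4) \<le> u A * v A" using dr by (intro mult_mono) auto
      then have "1 / (u A * v A) \<le> 1 / ((d / 4) * (d / 4))" using dr uv by (intro divide_left_mono mult_pos_pos) auto
      also have "\<dots> = 16 / d^2" by (simp add: power2_eq_square)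
      finally show ?thesis using uv m0 by (simp add: add_increasing)
    qed
    then have "d * (1 / (u A * v A)) \<le> d * (8 / d^2 * (e A * m A / (u A * v A)) + 16 / d^2)"
      using dr by (intro mult_left_mono) auto
    also have "\<dots> = 8 / d * (e A * m A / (u A * v A)) + 16 / d"
      using dr by (simp add: field_simps power2_eq_square)
    finally have 1: "d * (1 / (u A * v A)) \<le> 8 / d * (e A * m A / (u A * v A)) + 16 / d" .
    \<comment> \<open>The arithmetic-geometric mean inequality trades \<open>1 / u\<close> for
      \<open>1 / u^2\<close>, which is at most \<open>2 / (u * v)\<close> because
      \<open>v \<le> 2 * u\<close>; this brings in the weight of
      \<open>overlap_moment\<close>.\<close>
    have "0 \<le> (d / u A - 1)^2" by simp
    then have "2 * (d / u A) \<le> (d / u A)^2 + 1" by (simp add: power2_eq_square algebra_simps)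
    then have "(2 * (d / u A)) / (2 * d) \<le> ((d / u A)^2 + 1) / (2 * d)"
      using dr by (intro divide_right_mono) auto
    then have "1 / u A \<le> d / 2 * (1 / (u A * u A)) + 1 / (2 * d)"
      using dr uv by (simp add: field_simps power2_eq_square)
    moreover have "1 / (u A * u A) \<le> 2 * (1 / (u A * v A))"
    proof -
      have "1 / (u A * u A) = 2 / (u A * (2 * u A))" by simp
      also have "\<dots> \<le> 2 / (u A * v A)" using uv by (intro divide_left_mono mult_left_mono) auto
      finally show ?thesis by simp
    qed
    then have "d / 2 * (1 / (u A * u A)) \<le> d / 2 * (2 * (1 / (u A * v A)))"
      using dr by (intro mult_left_mono) auto
    ultimately have "1 / u A \<le> d * (1 / (u A * v A)) + 1 / (2 * d)" by simp
    also have "\<dots> \<le> 8 / d * (e A * m A / (u A * v A)) + 16 / d + 1 / (2 * d)" using 1 by simp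
    also have "\<dots> = 8 / d * (e A * m A / (u A * v A)) + 33 / (2 * d)" using dr by (simp add: field_simps)
    finally show ?thesis .
  qed
  have "(\<Sum>A\<in>?M. 1 / u A) \<le> (\<Sum>A\<in>?M. 8 / d * (e A * m A / (u A * v A)) + 33 / (2 * d))"
    by (rule sum_mono[OF pt])
  also have "\<dots> = 8 / d * (\<Sum>A\<in>?M. e A * m A / (u A * v A)) + 33 / (2 * d) * card ?M"
    by (simp add: sum.distrib sum_distrib_left)
  also have "\<dots> \<le> 8 / d * card ?M + 33 / (2 * d) * card ?M"
    using overlap_moment[OF fin pq, where d = d and s = s]
    by (intro add_right_mono mult_left_mono) (auto simp: e_def m_def u_def v_def)
  also have "\<dots> \<le> 25 / d * card ?M"
    using dr by (simp add: field_simps)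
  finally show ?thesis by (simp add: u_def e_def)
qed

text \<open>Each ratio in the double count falls short of 1 by
  \<open>(s p - s q - 1) / (s p - e)\<close>, at most \<open>k / (s p - e)\<close>, and
  \<open>sum_inverse_overlap_le\<close> bounds the average of the latter by
  \<open>25 * k / d\<close>. It is applied to the balanced margins, whose value at \<open>p\<close>
  is \<open>s p - 1\<close>; hence the \<open>+ 1\<close> in its denominator.\<close>

lemma card_bip_balance_le:
  assumes fin: "finite R" "finite C" and pq: "p \<in> C" "q \<in> C" "p \<noteq> q" and ab: "s q < s p"
    and R: "2 * d \<le> card R + k" and d: "50 * k \<le> d" "0 < d"
    and a: "s p \<le> d" and b: "d \<le> s q + k"
  shows "card (bip R C (\<lambda>_. d) (s(p := s p - 1, q := s q + 1))) \<le> (1 + 50 * real k / d) * card (bip R C (\<lambda>_. d) s)"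
proof -
  let ?s = "s(p := s p - 1, q := s q + 1)" and ?e = "\<lambda>A. card (col_set A p \<inter> col_set A q)"
  let ?M = "bip R C (\<lambda>_. d) ?s"
  have "(\<Sum>A\<in>?M. 1 - (real (s q) + 1 - ?e A) / (real (s p) - ?e A)) \<le> (\<Sum>A\<in>?M. k * (1 / (real (s p) - ?e A)))"
  proof (rule sum_mono)
    fix A assume A: "A \<in> ?M"
    have "finite (col_set A p)" using bipD(5)[OF A] fin finite_subset by metis
    then have "?e A \<le> card (col_set A p)" by (auto intro: card_mono)
    then have e: "?e A < s p" using bipD(3)[OF A pq(1)] pq ab by auto
    have "1 - (real (s q) + 1 - ?e A) / (real (s p) - ?e A) = (real (s p) - s q - 1) / (real (s p) - ?e A)"
      using e by (simp add: field_simps)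
    also have "\<dots> \<le> k / (real (s p) - ?e A)"
      using e a b by (intro divide_right_mono) auto
    finally show "1 - (real (s q) + 1 - ?e A) / (real (s p) - ?e A) \<le> k * (1 / (real (s p) - ?e A))" by simp
  qed
  also have "\<dots> = k * (\<Sum>A\<in>?M. 1 / (real (?s p) + 1 - ?e A))"
    using pq ab by (simp add: sum_distrib_left of_nat_diff)
  also have "\<dots> \<le> k * (25 / d * card ?M)"
    by (intro mult_left_mono sum_inverse_overlap_le[OF fin pq R]) (use pq ab a b d in auto)
  finally have *: "real (card ?M) - real (card (bip R C (\<lambda>_. d) s)) \<le> k * (25 / d * card ?M)"
    using card_bip_move[OF fin pq ab, of "\<lambda>_. d"] by (simp add: sum_subtractf)
  define x where "x = real k / d"
  have x: "0 \<le> x" "x \<le> 1 / 50" using d by (auto simp: x_def field_simps)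
  \<comment> \<open>With \<open>x \<le> 1 / 50\<close> the product
    \<open>(1 + 50 * x) * (1 - 25 * x)\<close> is at least 1; this is the origin of the requirement
    \<open>50 * k \<le> d\<close>.\<close>
  have xx: "50 * x * x \<le> x" using mult_right_mono[OF x(2) x(1)] by simp
  have "(1 - 25 * x) * card ?M \<le> card (bip R C (\<lambda>_. d) s)" using * by (simp add: x_def field_simps)
  then have "(1 + 50 * x) * ((1 - 25 * x) * card ?M) \<le> (1 + 50 * x) * card (bip R C (\<lambda>_. d) s)"
    using x by (intro mult_left_mono) auto
  moreover have "1 * real (card ?M) \<le> ((1 + 50 * x) * (1 - 25 * x)) * card ?M"
    using xx by (intro mult_right_mono) (auto simp: algebra_simps)
  ultimately show ?thesis by (simp add: x_def mult.assoc)
qed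
text \<open>Induction on the excess of \<open>s\<close> over \<open>t\<close>, as measured by
  truncated subtraction: a unit moves from a column above its target to one below and stays within
  the box. Either this move balances the two columns, and the count does not decrease, or the
  reverse move does, and the factor \<open>1 + 50 * k / d\<close> is paid.\<close>

lemma card_bip_box_le:
  assumes fin: "finite R" "finite C"
    and R: "2 * d \<le> card R + k" and d: "50 * k \<le> d" "0 < d"
    and s: "\<And>j. j \<in> C \<Longrightarrow> d \<le> s j + k \<and> s j \<le> d"
    and t: "\<And>j. j \<in> C \<Longrightarrow> d \<le> t j + k \<and> t j \<le> d" and st: "sum s C = sum t C"
  shows "card (bip R C (\<lambda>_. d) s) \<le> (1 + 50 * real k / d) ^ (\<Sum>j\<in>C. s j - t j) * card (bip R C (\<lambda>_. d) t)"
  using s st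
proof (induction "\<Sum>j\<in>C. s j - t j" arbitrary: s)
  case 0
  then have "s j \<le> t j" if "j \<in> C" for j using fin that by simp
  with 0(3) fin have "s j = t j" if "j \<in> C" for j
    using that sum_mono_inv[of s C t j] by simp
  then have "bip R C (\<lambda>_. d) s = bip R C (\<lambda>_. d) t" by (intro bip_cong) auto
  then show ?case using 0(1) by simp
next
  case (Suc m)
  have "\<exists>p\<in>C. t p < s p"
    by (rule ccontr) (use Suc(2) in \<open>auto simp: not_less\<close>)
  then obtain p where p: "p \<in> C" "t p < s p" by auto
  have "\<exists>q\<in>C. s q < t q"
  proof (rule ccontr)
    assume "\<not> ?thesis"
    then have "sum t C < sum s C" using p fin by (intro sum_strict_mono_ex1) (auto simp: not_less)
    then show False using Suc by simp
  qed
  then obtain q where q: "q \<in> C" "s q < t q" by auto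
  define s' where "s' = s(p := s p - 1, q := s q + 1)"
  have ne: "p \<noteq> q" using p q by auto
  have s': "d \<le> s' j + k \<and> s' j \<le> d" if "j \<in> C" for j
    using Suc(3)[OF that] t[OF that] p q ne by (auto simp: s'_def)
  have spl: "sum f C = f p + (f q + sum f (C - {p} - {q}))" for f :: "'b \<Rightarrow> nat"
    using p q ne fin by (simp add: sum.remove)
  have rest: "sum (\<lambda>j. s' j - t j) (C - {p} - {q}) = sum (\<lambda>j. s j - t j) (C - {p} - {q})"
     "sum s' (C - {p} - {q}) = sum s (C - {p} - {q})"
    by (intro sum.cong; simp add: s'_def)+
  have "m = (\<Sum>j\<in>C. s' j - t j)"
    using Suc(2) p q ne unfolding spl[of "\<lambda>j. s' j - t j"] spl[of "\<lambda>j. s j - t j"] rest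
    by (auto simp: s'_def)
  moreover have "sum s' C = sum t C"
    using Suc(4) p q ne unfolding spl[of s'] spl[of s] rest by (auto simp: s'_def)
  ultimately have IH: "card (bip R C (\<lambda>_. d) s') \<le> (1 + 50 * real k / d) ^ (\<Sum>j\<in>C. s' j - t j) * card (bip R C (\<lambda>_. d) t)"
    using Suc(1) s' by blast
  have "card (bip R C (\<lambda>_. d) s) \<le> (1 + 50 * real k / d) * card (bip R C (\<lambda>_. d) s')"
  proof (cases "s q < s p")
    case True
    have "card (bip R C (\<lambda>_. d) s) \<le> card (bip R C (\<lambda>_. d) s')"
      using card_bip_balance_ge[OF fin p(1) q(1) ne True] by (simp add: s'_def)
    moreover have "1 * real (card (bip R C (\<lambda>_. d) s')) \<le> (1 + 50 * real k / d) * card (bip R C (\<lambda>_. d) s')"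
      by (intro mult_right_mono) auto
    ultimately show ?thesis by linarith
  next
    case False
    have rev: "s'(q := (s' q) - 1, p := (s' p) + 1) = s" using p ne by (auto simp: s'_def fun_eq_iff)
    have "s' p < s' q" using False p ne by (auto simp: s'_def)
    from card_bip_balance_le[OF fin q(1) p(1) ne[symmetric] this R d] show ?thesis
      using s' p(1) q(1) unfolding rev by blast
  qed
  also have "\<dots> \<le> (1 + 50 * real k / d) * ((1 + 50 * real k / d) ^ m * card (bip R C (\<lambda>_. d) t))"
    using IH \<open>m = _\<close> by (intro mult_left_mono) auto
  finally show ?case unfolding Suc(2)[symmetric] by (simp add: mult_ac)
qed

subsection \<open>Prescribing a few rows\<close>

text \<open>The possible contents of the rows in \<open>J\<close>; column sums stay free, since the
  other rows make up for them.\<close>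

definition regular_blocks :: "'a set \<Rightarrow> 'b set \<Rightarrow> nat \<Rightarrow> ('a \<times> 'b) set set" where
  "regular_blocks J C d = {B. B \<subseteq> J \<times> C \<and> (\<forall>i\<in>J. card (row_set B i) = d)}"

lemma finite_regular_blocks: "finite J \<Longrightarrow> finite C \<Longrightarrow> finite (regular_blocks J C d)"
  by (rule finite_subset[of _ "Pow (J \<times> C)"]) (auto simp: regular_blocks_def)

lemma card_regular_blocks:
  assumes "finite J" "finite C"
  shows "card (regular_blocks J C d) = (card C choose d) ^ card J"
proof -
  let ?P = "\<Pi>\<^sub>E i\<in>J. {T. T \<subseteq> C \<and> card T = d}"
  have "bij_betw (\<lambda>B. \<lambda>i\<in>J. row_set B i) (regular_blocks J C d) ?P"
    by (rule bij_betw_byWitness[where f' = "\<lambda>f. {(i, j). i \<in> J \<and> j \<in> f i}"])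
      (auto simp: regular_blocks_def row_set_def restrict_def fun_eq_iff PiE_iff extensional_def)
  then have "card (regular_blocks J C d) = card ?P" by (rule bij_betw_same_card)
  then show ?thesis using assms by (simp add: card_PiE n_subsets)
qed

lemma sum_card_col_set:
  assumes "finite J" "finite C" "B \<in> regular_blocks J C d"
  shows "(\<Sum>j\<in>C. card (col_set B j)) = d * card J"
proof -
  have B: "B \<subseteq> J \<times> C" using assms by (simp add: regular_blocks_def)
  have "(\<Sum>j\<in>C. card (col_set B j)) = (\<Sum>j\<in>C. \<Sum>i\<in>J. if (i, j) \<in> B then 1 else 0)"
    using B assms by (intro sum.cong refl) (auto simp: col_set_def sum.If_cases intro!: arg_cong[of _ _ card])
  also have "\<dots> = (\<Sum>i\<in>J. \<Sum>j\<in>C. if (i, j) \<in> B then 1 else 0)" by (rule sum.swap)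
  also have "\<dots> = (\<Sum>i\<in>J. card (row_set B i))"
    using B assms by (intro sum.cong refl) (auto simp: row_set_def sum.If_cases intro!: arg_cong[of _ _ card])
  also have "\<dots> = d * card J" using assms by (simp add: regular_blocks_def)
  finally show ?thesis .
qed

text \<open>Removing the rows of \<open>J\<close> turns a completion of \<open>B\<close> into a
  matrix with the residual column sums; \<open>le\<close> keeps the subtraction from
  truncating.\<close>

lemma card_bip_extend:
  assumes fin: "finite R" "finite C" and J: "J \<subseteq> R" and B: "B \<in> regular_blocks J C d"
    and le: "\<And>j. j \<in> C \<Longrightarrow> card (col_set B j) \<le> e"
  shows "card {A \<in> bip R C (\<lambda>_. d) (\<lambda>_. e). A \<inter> (J \<times> C) = B}
    = card (bip (R - J) C (\<lambda>_. d) (\<lambda>j. e - card (col_set B j)))"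
proof -
  have BJ: "B \<subseteq> J \<times> C" "\<And>i. i \<in> J \<Longrightarrow> card (row_set B i) = d" using B by (auto simp: regular_blocks_def)
  have fJ: "finite J" using J fin finite_subset by blast
  have fc: "finite (col_set B j)" for j by (rule finite_subset[OF _ fJ]) (use BJ in \<open>auto simp: col_set_def\<close>)
  have c: "card (col_set (D \<union> B) j) = card (col_set D j) + card (col_set B j)" if "D \<subseteq> (R - J) \<times> C" for D j
  proof -
    have "col_set (D \<union> B) j = col_set D j \<union> col_set B j" by (auto simp: col_set_def)
    moreover have "finite (col_set D j)" by (rule finite_subset[OF _ fin(1)]) (use that in \<open>auto simp: col_set_def\<close>)
    moreover have "col_set D j \<inter> col_set B j = {}" using that BJ by (auto simp: col_set_def)
    ultimately show ?thesis using fc by (simp add: card_Un_disjoint)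
  qed
  have r: "row_set (D \<union> B) i = (if i \<in> J then row_set B i else row_set D i)" if "D \<subseteq> (R - J) \<times> C" for D i
    using that BJ by (auto simp: row_set_def)
  have "bij_betw (\<lambda>A. A - J \<times> C) {A \<in> bip R C (\<lambda>_. d) (\<lambda>_. e). A \<inter> (J \<times> C) = B}
     (bip (R - J) C (\<lambda>_. d) (\<lambda>j. e - card (col_set B j)))"
  proof (rule bij_betw_byWitness[where f' = "\<lambda>D. D \<union> B"])
    show "\<forall>a\<in>{A \<in> bip R C (\<lambda>_. d) (\<lambda>_. e). A \<inter> J \<times> C = B}. a - J \<times> C \<union> B = a" by auto
    show "\<forall>a'\<in>bip (R - J) C (\<lambda>_. d) (\<lambda>j. e - card (col_set B j)). a' \<union> B - J \<times> C = a'"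
      using BJ by (auto simp: bip_def)
    show "(\<lambda>A. A - J \<times> C) ` {A \<in> bip R C (\<lambda>_. d) (\<lambda>_. e). A \<inter> J \<times> C = B}
      \<subseteq> bip (R - J) C (\<lambda>_. d) (\<lambda>j. e - card (col_set B j))"
    proof (rule image_subsetI)
      fix A assume "A \<in> {A \<in> bip R C (\<lambda>_. d) (\<lambda>_. e). A \<inter> J \<times> C = B}"
      then have A: "A \<in> bip R C (\<lambda>_. d) (\<lambda>_. e)" and eq: "(A - J \<times> C) \<union> B = A" by auto
      have sub: "A - J \<times> C \<subseteq> (R - J) \<times> C" using bipD(1)[OF A] by auto
      have r': "card (row_set (A - J \<times> C) i) = d" if "i \<in> R - J" for i
        using bipD(2)[OF A, of i] r[OF sub, of i] that unfolding eq by auto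
      have c': "card (col_set (A - J \<times> C) j) = e - card (col_set B j)" if "j \<in> C" for j
        using bipD(3)[OF A that] c[OF sub, of j] unfolding eq by linarith
      show "A - J \<times> C \<in> bip (R - J) C (\<lambda>_. d) (\<lambda>j. e - card (col_set B j))"
        using sub r' c'
        by (simp add: bip_def)
    qed
    show "(\<lambda>D. D \<union> B) ` bip (R - J) C (\<lambda>_. d) (\<lambda>j. e - card (col_set B j))
      \<subseteq> {A \<in> bip R C (\<lambda>_. d) (\<lambda>_. e). A \<inter> J \<times> C = B}"
    proof (rule image_subsetI)
      fix D assume D: "D \<in> bip (R - J) C (\<lambda>_. d) (\<lambda>j. e - card (col_set B j))"
      have sub: "D \<subseteq> (R - J) \<times> C" using bipD(1)[OF D] .
      have "D \<union> B \<in> bip R C (\<lambda>_. d) (\<lambda>_. e)"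
        using sub BJ J bipD(2,3)[OF D] le by (auto simp: bip_def c[OF sub] r[OF sub])
      moreover have "(D \<union> B) \<inter> J \<times> C = B" using sub BJ by auto
      ultimately show "D \<union> B \<in> {A \<in> bip R C (\<lambda>_. d) (\<lambda>_. e). A \<inter> J \<times> C = B}" by simp
    qed
  qed
  then show ?thesis by (rule bij_betw_same_card)
qed

text \<open>With \<open>k = card J\<close>, any two blocks leave residual column sums in
  \<open>[d - k, d]\<close> with the same total, hence at most \<open>k * card C\<close> unit moves
  apart. Each move costs at most \<open>1 + 50 * k / d\<close>.\<close>

lemma card_bip_extend_comparable:
  assumes fin: "finite R" "finite C" and J: "J \<subseteq> R"
    and R: "2 * d \<le> card R" and d: "50 * card J \<le> d" "0 < d"
    and B: "B \<in> regular_blocks J C d" "B' \<in> regular_blocks J C d"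
  defines "F \<equiv> \<lambda>B. card {A \<in> bip R C (\<lambda>_. d) (\<lambda>_. d). A \<inter> (J \<times> C) = B}"
  shows "F B \<le> exp (50 * (card J)\<^sup>2 * card C / d) * F B'"
proof -
  let ?k = "card J"
  have fJ: "finite J" using J fin finite_subset by blast
  have ck: "card (col_set B j) \<le> ?k" if "B \<in> regular_blocks J C d" for B j
    by (rule card_mono[OF fJ]) (use that in \<open>auto simp: regular_blocks_def col_set_def\<close>)
  have cd: "card (col_set B j) \<le> d" if "B \<in> regular_blocks J C d" for B j
    using ck[OF that, of j] d by simp
  define s where "s B j = d - card (col_set B j)" for B :: "('a \<times> 'b) set" and j
  have F: "F B = card (bip (R - J) C (\<lambda>_. d) (s B))" if "B \<in> regular_blocks J C d" for B
    unfolding F_def s_def using cd[OF that] by (intro card_bip_extend fin J that)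
  have ss: "sum (s B) C = d * card C - d * ?k" if "B \<in> regular_blocks J C d" for B
    unfolding s_def using cd[OF that] sum_card_col_set[OF fJ fin(2) that] by (subst sum_subtractf_nat) (auto simp: mult.commute)
  have "card (bip (R - J) C (\<lambda>_. d) (s B))
    \<le> (1 + 50 * real ?k / d) ^ (\<Sum>j\<in>C. s B j - s B' j) * card (bip (R - J) C (\<lambda>_. d) (s B'))"
  proof (rule card_bip_box_le)
    \<comment> \<open>The slack \<open>k\<close> in the comparison of margins accounts for the
      \<open>k\<close> deleted rows.\<close>
    show "2 * d \<le> card (R - J) + ?k" using R card_Diff_subset[OF fJ J] card_mono[OF fin(1) J] by simp
    show "d \<le> s B j + card J \<and> s B j \<le> d" "d \<le> s B' j + card J \<and> s B' j \<le> d" for j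
      using ck[OF B(1), of j] ck[OF B(2), of j] by (auto simp: s_def)
  qed (use fin d ss B in auto)
  moreover have "(1 + 50 * real ?k / d) ^ (\<Sum>j\<in>C. s B j - s B' j) \<le> exp (50 * ?k\<^sup>2 * card C / d)"
  proof -
    have "(\<Sum>j\<in>C. s B j - s B' j) \<le> (\<Sum>j\<in>C. ?k)"
    proof (rule sum_mono)
      fix j show "s B j - s B' j \<le> ?k" using ck[OF B(2), of j] by (auto simp: s_def)
    qed
    then have "(1 + 50 * real ?k / d) ^ (\<Sum>j\<in>C. s B j - s B' j) \<le> (1 + 50 * real ?k / d) ^ (card C * ?k)"
      by (intro power_increasing) auto
    also have "\<dots> \<le> exp (50 * real ?k / d) ^ (card C * ?k)"
      by (intro power_mono exp_ge_add_one_self) auto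
    also have "\<dots> = exp (50 * ?k\<^sup>2 * card C / d)"
      by (simp flip: exp_of_nat_mult add: power2_eq_square mult_ac)
    finally show ?thesis .
  qed
  ultimately show ?thesis unfolding F[OF B(1)] F[OF B(2)]
    by (meson mult_right_mono of_nat_0_le_iff order_trans)
qed

text \<open>Averaging the comparison over all blocks \<open>B'\<close> shows that each block has at
  most the uniform probability times the exponential factor. The inequality is cleared of
  denominators.\<close>

lemma card_bip_event_le:
  assumes fin: "finite R" "finite C" and J: "J \<subseteq> R"
    and R: "2 * d \<le> card R" and d: "50 * card J \<le> d" "0 < d"
    and E: "E \<subseteq> regular_blocks J C d"
  defines "M \<equiv> bip R C (\<lambda>_. d) (\<lambda>_. d)"
  shows "real (card {A \<in> M. A \<inter> (J \<times> C) \<in> E}) * (card C choose d) ^ card J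
     \<le> exp (50 * (card J)\<^sup>2 * card C / d) * card E * card M"
proof -
  let ?K = "exp (50 * (card J)\<^sup>2 * card C / d)" and ?X = "regular_blocks J C d"
  define F where "F B = card {A \<in> M. A \<inter> (J \<times> C) = B}" for B
  have fM: "finite M" using finite_bip[OF fin] by (simp add: M_def)
  have fJ: "finite J" using J fin finite_subset by blast
  have fX: "finite ?X" using finite_regular_blocks[OF fJ fin(2)] .
  have fE: "finite E" using finite_subset[OF E fX] .
  have part: "card {A \<in> M. A \<inter> (J \<times> C) \<in> Y} = (\<Sum>B\<in>Y. F B)" if "finite Y" for Y
  proof -
    have "{A \<in> M. A \<inter> (J \<times> C) \<in> Y} = (\<Union>B\<in>Y. {A \<in> M. A \<inter> (J \<times> C) = B})" by auto
    then show ?thesis unfolding F_def using fM that by (simp add: card_UN_disjoint disjoint_iff)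
  qed
  have all: "{A \<in> M. A \<inter> (J \<times> C) \<in> ?X} = M"
  proof -
    have "A \<inter> (J \<times> C) \<in> ?X" if A: "A \<in> M" for A
    proof -
      have "row_set (A \<inter> (J \<times> C)) i = row_set A i" if "i \<in> J" for i
        using that bipD(1)[OF A[unfolded M_def]] by (auto simp: row_set_def)
      then show ?thesis using bipD(2)[OF A[unfolded M_def]] J by (auto simp: regular_blocks_def)
    qed
    then show ?thesis by auto
  qed
  have M: "card M = (\<Sum>B\<in>?X. F B)" using part[OF fX] unfolding all .
  have le: "F B * (card C choose d) ^ card J \<le> ?K * card M" if "B \<in> ?X" for B
  proof -
    have "(\<Sum>B'\<in>?X. real (F B)) \<le> (\<Sum>B'\<in>?X. ?K * F B')"
      unfolding F_def M_def by (intro sum_mono card_bip_extend_comparable fin J R d that)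
    also have "\<dots> = ?K * card M" by (simp add: M sum_distrib_left)
    finally show ?thesis using card_regular_blocks[OF fJ fin(2), of d] by (simp add: mult.commute)
  qed
  have "real (card {A \<in> M. A \<inter> (J \<times> C) \<in> E}) * (card C choose d) ^ card J
     = (\<Sum>B\<in>E. real (F B * (card C choose d) ^ card J))"
    by (simp add: part[OF fE] sum_distrib_right)
  also have "\<dots> \<le> (\<Sum>B\<in>E. ?K * card M)" by (rule sum_mono[OF le]) (use E in auto)
  finally show ?thesis by (simp add: mult_ac)
qed

subsection \<open>Comparison with independent entries\<close>

text \<open>The probability that a random subset of \<open>J\<close>, containing each element
  independently with probability \<open>l\<close>, equals \<open>T\<close>; \<open>bern_mean\<close>
  is the corresponding expectation. In the application \<open>J\<close> is a set of rows and
  \<open>T\<close> the content of one column in these rows.\<close>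

definition bern :: "real \<Rightarrow> 'a set \<Rightarrow> 'a set \<Rightarrow> real" where
  "bern l J T = (\<Prod>i\<in>J. if i \<in> T then l else 1 - l)"

definition bern_mean :: "real \<Rightarrow> 'a set \<Rightarrow> ('a set \<Rightarrow> real) \<Rightarrow> real" where
  "bern_mean l J f = (\<Sum>T\<in>Pow J. bern l J T * f T)"

lemma bern_nonneg: "0 \<le> l \<Longrightarrow> l \<le> 1 \<Longrightarrow> 0 \<le> bern l J T"
  by (auto simp: bern_def intro!: prod_nonneg)

lemma bern_mean_empty [simp]: "bern_mean l {} f = f {}"
  by (simp add: bern_mean_def bern_def)

text \<open>Conditioning on whether \<open>x\<close> is chosen; explicit expectations are computed
  by iterating this.\<close>

lemma bern_mean_insert:
  assumes "finite J" "x \<notin> J"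
  shows "bern_mean l (insert x J) f = l * bern_mean l J (\<lambda>T. f (insert x T)) + (1 - l) * bern_mean l J f"
proof -
  have 1: "bern l (insert x J) (insert x T) = l * bern l J T" for T
    using assms by (auto simp: bern_def intro!: prod.cong)
  have 2: "bern l (insert x J) T = (1 - l) * bern l J T" if "T \<subseteq> J" for T
    using assms that by (auto simp: bern_def)
  have "bern_mean l (insert x J) f = (\<Sum>T\<in>Pow J. bern l (insert x J) T * f T)
     + (\<Sum>T\<in>insert x ` Pow J. bern l (insert x J) T * f T)"
    unfolding bern_mean_def Pow_insert using assms by (intro sum.union_disjoint) auto
  also have "(\<Sum>T\<in>insert x ` Pow J. bern l (insert x J) T * f T) = (\<Sum>T\<in>Pow J. bern l (insert x J) (insert x T) * f (insert x T))"
    using assms(2) by (subst sum.reindex) (auto simp: inj_on_def)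
  also have "\<dots> = l * bern_mean l J (\<lambda>T. f (insert x T))"
    by (simp add: 1 bern_mean_def sum_distrib_left mult_ac)
  also have "(\<Sum>T\<in>Pow J. bern l (insert x J) T * f T) = (1 - l) * bern_mean l J f"
    using 2 by (auto simp: bern_mean_def sum_distrib_left mult_ac intro!: sum.cong)
  finally show ?thesis by simp
qed

lemma bern_mean_const: "finite J \<Longrightarrow> bern_mean l J (\<lambda>_. c) = c"
  by (induction J rule: finite_induct) (auto simp: bern_mean_insert algebra_simps)

lemma bern_mean_add: "bern_mean l J (\<lambda>T. f T + g T) = bern_mean l J f + bern_mean l J g"
  by (simp add: bern_mean_def algebra_simps sum.distrib)

lemma bern_mean_cmult: "bern_mean l J (\<lambda>T. c * f T) = c * bern_mean l J f"
  by (simp add: bern_mean_def sum_distrib_left mult_ac)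

lemma bern_mean_mono:
  assumes "0 \<le> l" "l \<le> 1" "\<And>T. T \<subseteq> J \<Longrightarrow> f T \<le> g T"
  shows "bern_mean l J f \<le> bern_mean l J g"
  unfolding bern_mean_def using assms by (intro sum_mono mult_left_mono bern_nonneg) auto

section \<open>Chernoff bound for independent columns\<close>

lemma exp_le_quadratic:
  fixes x :: real
  assumes "\<bar>x\<bar> \<le> 1"
  shows "exp x \<le> 1 + x + x\<^sup>2"
proof (cases "0 \<le> x")
  case True then show ?thesis using exp_bound[of x] assms by simp
next
  case False
  define y where "y = - x"
  have y: "0 \<le> y" "y \<le> 1" using False assms by (auto simp: y_def)
  have q: "0 < 1 - y + y\<^sup>2" using y by (cases "y = 1") (auto simp: add_pos_nonneg)
  \<comment> \<open>For negative arguments the bound is inverted: \<open>1 - y + y^2\<close> times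
    the quadratic Taylor minorant of \<open>exp y\<close> is already at least 1.\<close>
  have "1 \<le> (1 - y + y\<^sup>2) * (1 + y + y\<^sup>2 / 2)"
  proof -
    have "(1 - y + y\<^sup>2) * (1 + y + y\<^sup>2 / 2) = 1 + y\<^sup>2 / 2 + y^3 / 2 + y^4 / 2"
      by (simp add: field_simps power2_eq_square power3_eq_cube power4_eq_xxxx)
    then show ?thesis using y by simp
  qed
  also have "\<dots> \<le> (1 - y + y\<^sup>2) * exp y"
    using q exp_lower_Taylor_quadratic[OF y(1)] by (intro mult_left_mono) auto
  finally have "exp (- y) \<le> 1 - y + y\<^sup>2" by (simp add: exp_minus field_simps)
  then show ?thesis by (simp add: y_def)
qed

text \<open>In the quadratic bound for the exponential the linear term vanishes because
  \<open>f\<close> has mean 0, leaving \<open>1 + t^2\<close>.\<close>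

lemma bern_mean_exp_le:
  assumes "finite J" "0 \<le> l" "l \<le> 1" "\<And>T. T \<subseteq> J \<Longrightarrow> \<bar>f T\<bar> \<le> 1" "bern_mean l J f = 0"
    and t: "0 \<le> t" "t \<le> 1"
  shows "bern_mean l J (\<lambda>T. exp (t * f T)) \<le> exp (t\<^sup>2)"
proof -
  have "bern_mean l J (\<lambda>T. exp (t * f T)) \<le> bern_mean l J (\<lambda>T. (1 + t\<^sup>2) + t * f T)"
  proof (rule bern_mean_mono[OF assms(2,3)])
    fix T assume T: "T \<subseteq> J"
    have "\<bar>t * f T\<bar> \<le> t * 1" using assms(4)[OF T] t unfolding abs_mult by (intro mult_mono) auto
    then have a: "\<bar>t * f T\<bar> \<le> t" by simp
    then have "exp (t * f T) \<le> 1 + t * f T + (t * f T)\<^sup>2" using t by (intro exp_le_quadratic) auto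
    also have "(t * f T)\<^sup>2 \<le> t\<^sup>2" using a t by (simp add: abs_le_square_iff[symmetric])
    finally show "exp (t * f T) \<le> (1 + t\<^sup>2) + t * f T" by simp
  qed
  also have "\<dots> = 1 + t\<^sup>2" unfolding bern_mean_add bern_mean_cmult bern_mean_const[OF assms(1)] assms(5) by simp
  also have "\<dots> \<le> exp (t\<^sup>2)" by (rule exp_ge_add_one_self)
  finally show ?thesis .
qed

text \<open>A matrix is an arbitrary family of columns, so the sum factorises; this is the
  independence of the columns.\<close>

lemma sum_Pow_Times_prod:
  fixes g :: "'b \<Rightarrow> 'a set \<Rightarrow> real"
  assumes "finite J" "finite C"
  shows "(\<Sum>B\<in>Pow (J \<times> C). \<Prod>j\<in>C. g j (col_set B j)) = (\<Prod>j\<in>C. \<Sum>T\<in>Pow J. g j T)"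
proof -
  have "(\<Sum>B\<in>Pow (J \<times> C). \<Prod>j\<in>C. g j (col_set B j)) = (\<Sum>f\<in>(\<Pi>\<^sub>E j\<in>C. Pow J). \<Prod>j\<in>C. g j (f j))"
    by (rule sum.reindex_bij_witness[where j = "\<lambda>B. \<lambda>j\<in>C. col_set B j" and i = "\<lambda>f. {(i, j). j \<in> C \<and> i \<in> f j}"])
      (auto simp: col_set_def restrict_def fun_eq_iff PiE_iff extensional_def Pow_def)
  also have "\<dots> = (\<Prod>j\<in>C. \<Sum>T\<in>Pow J. g j T)" using assms by (simp add: prod_sum_PiE)
  finally show ?thesis .
qed

text \<open>Every row has exactly \<open>d\<close> ones, so all regular blocks are equally likely
  under independent entries.\<close>

lemma prod_bern_regular_block:
  assumes fin: "finite J" "finite C" and B: "B \<in> regular_blocks J C d"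
  shows "(\<Prod>j\<in>C. bern l J (col_set B j)) = (l ^ d * (1 - l) ^ (card C - d)) ^ card J"
proof -
  have BJ: "B \<subseteq> J \<times> C" "\<And>i. i \<in> J \<Longrightarrow> card (row_set B i) = d" using B by (auto simp: regular_blocks_def)
  have "(\<Prod>j\<in>C. bern l J (col_set B j)) = (\<Prod>i\<in>J. \<Prod>j\<in>C. if (i, j) \<in> B then l else 1 - l)"
    unfolding bern_def col_set_def by (subst prod.swap) simp
  also have "\<dots> = (\<Prod>i\<in>J. l ^ d * (1 - l) ^ (card C - d))"
  proof (rule prod.cong[OF refl])
    fix i assume i: "i \<in> J"
    have "C \<inter> {j. (i, j) \<in> B} = row_set B i" "C \<inter> - {j. (i, j) \<in> B} = C - row_set B i"
      using BJ by (auto simp: row_set_def)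
    moreover have "row_set B i \<subseteq> C" using BJ by (auto simp: row_set_def)
    ultimately show "(\<Prod>j\<in>C. if (i, j) \<in> B then l else 1 - l) = l ^ d * (1 - l) ^ (card C - d)"
      using BJ(2)[OF i] fin finite_subset[of "row_set B i" C] by (simp add: prod.If_cases card_Diff_subset)
  qed
  finally show ?thesis by simp
qed

text \<open>By \<open>prod_bern_regular_block\<close> the left side is the probability of
  \<open>E\<close> under independent entries, and the exponential Markov inequality with parameter
  \<open>t\<close> bounds it.\<close>

lemma chernoff_regular_blocks:
  fixes l t x :: real and d :: nat and f :: "'a set \<Rightarrow> real"
  assumes fin: "finite J" "finite C" and l: "0 \<le> l" "l \<le> 1"
    and f: "\<And>T. T \<subseteq> J \<Longrightarrow> \<bar>f T\<bar> \<le> 1" "bern_mean l J f = 0" and S: "S \<subseteq> C" and t: "0 \<le> t" "t \<le> 1"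
  defines "E \<equiv> {B \<in> regular_blocks J C d. x \<le> (\<Sum>j\<in>S. f (col_set B j))}"
  shows "card E * (l ^ d * (1 - l) ^ (card C - d)) ^ card J \<le> exp (t\<^sup>2 * card C - t * x)"
proof -
  define g where "g j T = bern l J T * exp (if j \<in> S then t * f T else 0)" for j T
  have W: "(\<Prod>j\<in>C. g j (col_set B j)) = (\<Prod>j\<in>C. bern l J (col_set B j)) * exp (t * (\<Sum>j\<in>S. f (col_set B j)))" for B
  proof -
    have "(\<Sum>j\<in>C. if j \<in> S then t * f (col_set B j) else 0) = (\<Sum>j\<in>S. t * f (col_set B j))"
      using S fin by (simp add: sum.If_cases Int_absorb1)
    then show ?thesis unfolding g_def prod.distrib using fin by (simp add: sum_distrib_left flip: exp_sum)
  qed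
  have "real (card E) * (l ^ d * (1 - l) ^ (card C - d)) ^ card J * exp (t * x)
     = (\<Sum>B\<in>E. (l ^ d * (1 - l) ^ (card C - d)) ^ card J * exp (t * x))" by simp
  also have "\<dots> \<le> (\<Sum>B\<in>E. \<Prod>j\<in>C. g j (col_set B j))"
  proof (rule sum_mono)
    fix B assume B: "B \<in> E"
    have "exp (t * x) \<le> exp (t * (\<Sum>j\<in>S. f (col_set B j)))" using B t by (auto simp: E_def intro: mult_left_mono)
    then show "(l ^ d * (1 - l) ^ (card C - d)) ^ card J * exp (t * x) \<le> (\<Prod>j\<in>C. g j (col_set B j))"
      unfolding W using B prod_bern_regular_block[OF fin, of B d l] l by (auto simp: E_def intro!: mult_left_mono)
  qed
  also have "\<dots> \<le> (\<Sum>B\<in>Pow (J \<times> C). \<Prod>j\<in>C. g j (col_set B j))"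
    using fin l by (intro sum_mono2) (auto simp: E_def regular_blocks_def g_def bern_nonneg intro!: prod_nonneg)
  also have "\<dots> = (\<Prod>j\<in>C. \<Sum>T\<in>Pow J. g j T)" by (rule sum_Pow_Times_prod[OF fin])
  also have "\<dots> \<le> (\<Prod>j\<in>C. exp (t\<^sup>2))"
  proof (rule prod_mono)
    fix j assume "j \<in> C"
    \<comment> \<open>Columns outside \<open>S\<close> contribute exactly 1; bounding them by
      \<open>exp (t^2)\<close> as well gives an exponent with \<open>card C\<close> in place of
      \<open>card S\<close>.\<close>
    have "(\<Sum>T\<in>Pow J. g j T) \<le> exp (t\<^sup>2)"
    proof (cases "j \<in> S")
      case True
      then show ?thesis using bern_mean_exp_le[OF fin(1) l f t] by (simp add: g_def bern_mean_def)
    next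
      case False
      then have "(\<Sum>T\<in>Pow J. g j T) = 1" using bern_mean_const[OF fin(1), of l 1] by (simp add: g_def bern_mean_def)
      then show ?thesis by simp
    qed
    then show "0 \<le> (\<Sum>T\<in>Pow J. g j T) \<and> (\<Sum>T\<in>Pow J. g j T) \<le> exp (t\<^sup>2)"
      using l by (auto simp: g_def bern_nonneg intro!: sum_nonneg)
  qed
  also have "\<dots> = exp (t\<^sup>2 * card C)" by (simp add: mult.commute flip: exp_of_nat_mult)
  finally show ?thesis by (simp add: exp_diff pos_le_divide_eq)
qed

section \<open>From independent entries back to rows of fixed weight\<close>

lemma binomial_mode_ge:
  fixes l :: real
  assumes l: "0 < l" "l < 1" and d: "real d = l * n"
  shows "1 \<le> (real n + 1) * ((n choose d) * (l ^ d * (1 - l) ^ (n - d)))"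
proof -
  \<comment> \<open>\<open>b m\<close> is the binomial probability of \<open>m\<close>. Consecutive
    ratios show that it increases up to \<open>d = l * n\<close> and decreases afterwards, so
    \<open>d\<close> is a mode; the \<open>n + 1\<close> probabilities sum to 1, hence
    \<open>b d \<ge> 1 / (n + 1)\<close>.\<close>
  define b where "b m = real (n choose m) * (l ^ m * (1 - l) ^ (n - m))" for m
  have dn: "d \<le> n" using d l mult_left_le_one_le[of "real n" l] by simp
  have step: "b (Suc m) * (real (Suc m) * (1 - l)) = b m * (real (n - m) * l)" if "m < n" for m
  proof -
    have "real (Suc m) * real (n choose Suc m) = real (n - m) * real (n choose m)"
    proof -
      have "Suc m * (n choose Suc m) = (n - m) * (n choose m)"
        using binomial_absorption[of m n] binomial_absorb_comp[of n m] that by simp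
      then show ?thesis by (metis of_nat_mult)
    qed
    moreover have "(1 - l) ^ (n - m) = (1 - l) * (1 - l) ^ (n - Suc m)"
      using that by (metis Suc_diff_Suc power_Suc)
    moreover have "x * (l * p * z) * (u * (1 - l)) = y * (p * ((1 - l) * z)) * (v * l)"
      if "u * x = v * y" for x y z p u v :: real
    proof -
      have "x * (l * p * z) * (u * (1 - l)) = (u * x) * (l * p * z * (1 - l))" by (simp only: mult_ac)
      then show ?thesis unfolding that by (simp only: mult_ac)
    qed
    ultimately show ?thesis unfolding b_def power_Suc by metis
  qed
  have pos: "0 \<le> b m" for m using l by (simp add: b_def)
  have up: "b m \<le> b (Suc m)" if "m < d" for m
  proof -
    have "real (Suc m) \<le> l * n" using that unfolding d[symmetric] by simp
    then have "real (Suc m) * (1 - l) \<le> real (n - m) * l"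
      using that dn l by (simp add: of_nat_diff algebra_simps)
    then have "b m * (real (Suc m) * (1 - l)) \<le> b m * (real (n - m) * l)" using pos by (intro mult_left_mono)
    then have "b m * (real (Suc m) * (1 - l)) \<le> b (Suc m) * (real (Suc m) * (1 - l))" using step[of m] that dn by simp
    then show ?thesis using l by (simp add: mult_le_cancel_right)
  qed
  have down: "b (Suc m) \<le> b m" if "d \<le> m" for m
  proof (cases "m < n")
    case True
    have "l * n \<le> real m" using that unfolding d[symmetric] by simp
    then have "real (n - m) * l \<le> real (Suc m) * (1 - l)"
      using True l by (simp add: of_nat_diff algebra_simps)
    then have "b m * (real (n - m) * l) \<le> b m * (real (Suc m) * (1 - l))" using pos by (intro mult_left_mono)
    then have "b (Suc m) * (real (Suc m) * (1 - l)) \<le> b m * (real (Suc m) * (1 - l))" using step[of m] True by simp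
    then show ?thesis using l by (simp add: mult_le_cancel_right)
  next
    case False
    then have "b (Suc m) = 0" by (simp add: b_def)
    then show ?thesis using pos by simp
  qed
  have "b m \<le> b d" for m
  proof (cases "m \<le> d")
    case True then show ?thesis
      by (induction rule: inc_induct) (use up in \<open>auto intro: order_trans\<close>)
  next
    case False
    then have "d \<le> m" by simp
    then show ?thesis
      by (induction rule: dec_induct) (use down in \<open>auto intro: order_trans\<close>)
  qed
  then have "(\<Sum>m\<le>n. b m) \<le> (\<Sum>m\<le>n. b d)" by (rule sum_mono)
  moreover have "(\<Sum>m\<le>n. b m) = 1"
    using binomial_ring[of l "1 - l" n] by (simp add: b_def mult.assoc)
  ultimately show ?thesis by (simp add: b_def algebra_simps)
qed

text \<open>The threshold \<open>2 * t * card C\<close> leaves the exponent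
  \<open>t^2 - 2 * t^2 = - t^2\<close> per column. Each row of \<open>J\<close> costs a factor
  \<open>card C + 1\<close> for having weight exactly \<open>d\<close>, and
  \<open>card C / d = 1 / l\<close> makes the comparison factor constant.\<close>

lemma card_bip_chernoff:
  fixes l t :: real and f :: "'a set \<Rightarrow> real"
  assumes fin: "finite R" "finite C" and J: "J \<subseteq> R"
    and R: "card R = card C" and l: "0 < l" "l \<le> 1 / 2" and dl: "real d = l * card C" and d: "50 * card J \<le> d" "0 < d"
    and f: "\<And>T. T \<subseteq> J \<Longrightarrow> \<bar>f T\<bar> \<le> 1" "bern_mean l J f = 0" and S: "S \<subseteq> C" and t: "0 \<le> t" "t \<le> 1"
  defines "M \<equiv> bip R C (\<lambda>_. d) (\<lambda>_. d)"
  shows "card {A \<in> M. 2 * t * card C \<le> (\<Sum>j\<in>S. f (col_set A j \<inter> J))}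
     \<le> exp (50 * (card J)\<^sup>2 / l) * (real (card C) + 1) ^ card J * exp (- (t\<^sup>2 * card C)) * card M"
proof -
  let ?n = "card C" and ?k = "card J"
  define w where "w = l ^ d * (1 - l) ^ (?n - d)"
  define E where "E = {B \<in> regular_blocks J C d. 2 * t * ?n \<le> (\<Sum>j\<in>S. f (col_set B j))}"
  define X where "X = real (card {A \<in> M. A \<inter> (J \<times> C) \<in> E})"
  have fJ: "finite J" using J fin finite_subset by blast
  have n0: "0 < real ?n" using dl d l by (cases "?n = 0") auto
  have d2: "2 * d \<le> card R"
  proof -
    have "l * ?n \<le> 1 / 2 * ?n" using l by (intro mult_right_mono) auto
    then show ?thesis unfolding R dl[symmetric] by simp
  qed
  have eq: "{A \<in> M. 2 * t * ?n \<le> (\<Sum>j\<in>S. f (col_set A j \<inter> J))} = {A \<in> M. A \<inter> (J \<times> C) \<in> E}"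
  proof -
    have "A \<inter> (J \<times> C) \<in> E \<longleftrightarrow> 2 * t * ?n \<le> (\<Sum>j\<in>S. f (col_set A j \<inter> J))" if A: "A \<in> M" for A
    proof -
      have "row_set (A \<inter> (J \<times> C)) i = row_set A i" if "i \<in> J" for i
        using that bipD(1)[OF A[unfolded M_def]] by (auto simp: row_set_def)
      then have "A \<inter> (J \<times> C) \<in> regular_blocks J C d"
        using bipD(2)[OF A[unfolded M_def]] J by (auto simp: regular_blocks_def)
      moreover have "col_set (A \<inter> (J \<times> C)) j = col_set A j \<inter> J" if "j \<in> S" for j
        using that S by (auto simp: col_set_def)
      ultimately show ?thesis by (simp add: E_def)
    qed
    then show ?thesis by auto
  qed
  have w0: "0 < w" using l by (simp add: w_def)
  have K: "50 * (card J)\<^sup>2 * card C / d = 50 * (card J)\<^sup>2 / l"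
    using dl d l n0 by (simp add: field_simps)
  have ev: "X * (?n choose d) ^ ?k \<le> exp (50 * ?k\<^sup>2 / l) * card E * card M"
    using card_bip_event_le[OF fin J d2 d, of E] unfolding K M_def X_def by (auto simp: E_def)
  have ch: "card E * w ^ ?k \<le> exp (- (t\<^sup>2 * ?n))"
    using chernoff_regular_blocks[OF fJ fin(2) _ _ f S t, of d "2 * t * ?n"] l
    unfolding E_def w_def by (simp add: power2_eq_square algebra_simps)
  have "X * 1 \<le> X * ((real ?n + 1) * ((?n choose d) * w)) ^ ?k"
    unfolding w_def using binomial_mode_ge[OF l(1) _ dl] l by (intro mult_left_mono one_le_power) (auto simp: X_def)
  also have "\<dots> = X * (?n choose d) ^ ?k * ((real ?n + 1) ^ ?k * w ^ ?k)" by (simp add: power_mult_distrib)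
  also have "\<dots> \<le> exp (50 * ?k\<^sup>2 / l) * card E * card M * ((real ?n + 1) ^ ?k * w ^ ?k)"
    using ev w0 by (intro mult_right_mono) auto
  also have "\<dots> = exp (50 * ?k\<^sup>2 / l) * (real ?n + 1) ^ ?k * card M * (card E * w ^ ?k)" by simp
  also have "\<dots> \<le> exp (50 * ?k\<^sup>2 / l) * (real ?n + 1) ^ ?k * card M * exp (- (t\<^sup>2 * ?n))"
    using ch by (intro mult_left_mono) auto
  finally show ?thesis unfolding eq X_def by (simp add: mult_ac)
qed

subsection \<open>The three events\<close>

text \<open>The content of column \<open>k\<close> in the rows \<open>J\<close>, encoded as a subset
  of \<open>J\<close> so that functions averaged by \<open>bern_mean\<close> apply to it.\<close>

definition pattern :: "int mat \<Rightarrow> nat set \<Rightarrow> nat \<Rightarrow> nat set" where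
  "pattern A J k = {i \<in> J. A $$ (i, k) = 1}"

lemma reg_mats_entry: "A \<in> reg_mats n d \<Longrightarrow> i < n \<Longrightarrow> j < n \<Longrightarrow> A $$ (i, j) = 0 \<or> A $$ (i, j) = 1"
  by (simp add: reg_mats_def)

text \<open>A sum of 0/1 entries counts the ones; this carries the counting results over to integer
  matrices.\<close>

lemma bij_betw_reg_mats:
  "bij_betw (\<lambda>A. {(i, j). i < n \<and> j < n \<and> A $$ (i, j) = 1}) (reg_mats n d) (bip {..<n} {..<n} (\<lambda>_. d) (\<lambda>_. d))"
proof -
  let ?f = "\<lambda>A :: int mat. {(i, j). i < n \<and> j < n \<and> A $$ (i, j) = 1}"
  let ?g = "\<lambda>X. mat n n (\<lambda>(i, j). if (i, j) \<in> X then 1 else (0 :: int))"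
  have count: "(\<Sum>x<n. a x) = int (card {x. x < n \<and> a x = 1})" if "\<And>x. x < n \<Longrightarrow> a x \<in> {0, 1}" for a
  proof -
    have "(\<Sum>x<n. a x) = (\<Sum>x<n. if a x = 1 then 1 else 0)" using that by (intro sum.cong) auto
    then show ?thesis by (simp add: sum.If_cases lessThan_def Collect_conj_eq)
  qed
  show ?thesis
  proof (rule bij_betw_byWitness[where f' = ?g])
    show "\<forall>A\<in>reg_mats n d. ?g (?f A) = A"
    proof (intro ballI eq_matI)
      fix A i j assume A: "A \<in> reg_mats n d" and "i < dim_row A" "j < dim_col A"
      then have ij: "i < n" "j < n" by (auto simp: reg_mats_def)
      show "?g (?f A) $$ (i, j) = A $$ (i, j)"
        using reg_mats_entry[OF A ij] ij by auto
    qed (auto simp: reg_mats_def)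
    show "\<forall>X\<in>bip {..<n} {..<n} (\<lambda>_. d) (\<lambda>_. d). ?f (?g X) = X"
      by (auto simp: bip_def split: if_splits)
    show "?f ` reg_mats n d \<subseteq> bip {..<n} {..<n} (\<lambda>_. d) (\<lambda>_. d)"
    proof (rule image_subsetI)
      fix A assume A: "A \<in> reg_mats n d"
      have "card {j. j < n \<and> A $$ (i, j) = 1} = d" if "i < n" for i
        using count[of "\<lambda>j. A $$ (i, j)"] A that by (simp add: reg_mats_def)
      moreover have "card {i. i < n \<and> A $$ (i, j) = 1} = d" if "j < n" for j
        using count[of "\<lambda>i. A $$ (i, j)"] A that by (simp add: reg_mats_def)
      ultimately show "?f A \<in> bip {..<n} {..<n} (\<lambda>_. d) (\<lambda>_. d)"
        by (auto simp: bip_def row_set_def col_set_def)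
    qed
    show "?g ` bip {..<n} {..<n} (\<lambda>_. d) (\<lambda>_. d) \<subseteq> reg_mats n d"
    proof (rule image_subsetI)
      fix X assume X: "X \<in> bip {..<n} {..<n} (\<lambda>_. d) (\<lambda>_. d)"
      have r: "{j. j < n \<and> ?g X $$ (i, j) = 1} = row_set X i" if "i < n" for i
        using bipD(1)[OF X] that by (auto simp: row_set_def split: if_splits)
      have c: "{i. i < n \<and> ?g X $$ (i, j) = 1} = col_set X j" if "j < n" for j
        using bipD(1)[OF X] that by (auto simp: col_set_def split: if_splits)
      have "(\<Sum>j<n. ?g X $$ (i, j)) = int d" if "i < n" for i
        using count[of "\<lambda>j. ?g X $$ (i, j)"] bipD(2)[OF X, of i] that unfolding r[OF that] by simp
      moreover have "(\<Sum>i<n. ?g X $$ (i, j)) = int d" if "j < n" for j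
        using count[of "\<lambda>i. ?g X $$ (i, j)"] bipD(3)[OF X, of j] that unfolding c[OF that] by simp
      ultimately show "?g X \<in> reg_mats n d" by (simp add: reg_mats_def)
    qed
  qed
qed

lemma finite_reg_mats: "finite (reg_mats n d)"
  using bij_betw_finite[OF bij_betw_reg_mats] finite_bip by blast

lemma reg_mats_chernoff:
  fixes l t :: real and f :: "nat set \<Rightarrow> real"
  assumes l: "0 < l" "l \<le> 1 / 2" and dl: "real d = l * n" and d: "50 * k \<le> d" "0 < d"
    and J: "J \<subseteq> {..<n}" "card J = k" and f: "\<And>T. T \<subseteq> J \<Longrightarrow> \<bar>f T\<bar> \<le> 1" "bern_mean l J f = 0"
    and S: "S \<subseteq> {..<n}" and t: "0 \<le> t" "t \<le> 1"
  shows "card {A \<in> reg_mats n d. 2 * t * n \<le> (\<Sum>j\<in>S. f (pattern A J j))}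
     \<le> exp (50 * (real k)\<^sup>2 / l) * (real n + 1) ^ k * exp (- (t\<^sup>2 * n)) * card (reg_mats n d)"
proof -
  let ?F = "\<lambda>A :: int mat. {(i, j). i < n \<and> j < n \<and> A $$ (i, j) = 1}" and ?M = "bip {..<n} {..<n} (\<lambda>_. d) (\<lambda>_. d)"
  let ?P = "\<lambda>X. 2 * t * n \<le> (\<Sum>j\<in>S. f (col_set X j \<inter> J))"
  have eq: "(\<Sum>j\<in>S. f (pattern A J j)) = (\<Sum>j\<in>S. f (col_set (?F A) j \<inter> J))" for A
    using S J by (intro sum.cong refl arg_cong[of _ _ f]) (auto simp: pattern_def col_set_def)
  have "?F ` {A \<in> reg_mats n d. 2 * t * n \<le> (\<Sum>j\<in>S. f (pattern A J j))} \<subseteq> {X \<in> ?M. ?P X}"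
    using bij_betwE[OF bij_betw_reg_mats[of n d]] unfolding eq by blast
  moreover have "inj_on ?F {A \<in> reg_mats n d. 2 * t * n \<le> (\<Sum>j\<in>S. f (pattern A J j))}"
    by (rule inj_on_subset[OF bij_betw_imp_inj_on[OF bij_betw_reg_mats[of n d]]]) auto
  ultimately have "card {A \<in> reg_mats n d. 2 * t * n \<le> (\<Sum>j\<in>S. f (pattern A J j))} \<le> card {X \<in> ?M. ?P X}"
    by (intro card_inj_on_le[of ?F]) (auto intro: finite_subset[OF _ finite_bip])
  then have "real (card {A \<in> reg_mats n d. 2 * t * n \<le> (\<Sum>j\<in>S. f (pattern A J j))}) \<le> card {X \<in> ?M. ?P X}"
    by simp
  also have "card {X \<in> ?M. ?P X} \<le> exp (50 * (real k)\<^sup>2 / l) * (real n + 1) ^ k * exp (- (t\<^sup>2 * n)) * card ?M"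
    using card_bip_chernoff[of "{..<n}" "{..<n}" J l d f S t] assms by auto
  also have "card ?M = card (reg_mats n d)" using bij_betw_same_card[OF bij_betw_reg_mats[of n d]] by simp
  finally show ?thesis .
qed

section \<open>Union bounds over tuples of rows\<close>

lemma poly_exp_decay:
  fixes a K :: real
  assumes "0 < a" "0 < K"
  shows "eventually (\<lambda>n. K * (real n + 1) ^ m * exp (- (a * real n)) \<le> exp (- (a / 2 * real n))) sequentially"
  using assms by real_asymp

lemma card_Union_le_mult:
  fixes b :: real
  assumes "finite I" "B \<subseteq> (\<Union>x\<in>I. X x)" "\<And>x. x \<in> I \<Longrightarrow> finite (X x)" "\<And>x. x \<in> I \<Longrightarrow> real (card (X x)) \<le> b"
  shows "card B \<le> card I * b"
proof -
  have "card B \<le> card (\<Union>x\<in>I. X x)" using assms by (intro card_mono) auto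
  also have "\<dots> \<le> (\<Sum>x\<in>I. card (X x))" by (rule card_UN_le[OF assms(1)])
  finally have "real (card B) \<le> (\<Sum>x\<in>I. real (card (X x)))" by (simp flip: of_nat_sum)
  also have "\<dots> \<le> card I * b" using assms(4) sum_bounded_above[of I "\<lambda>x. real (card (X x))" b] by simp
  finally show ?thesis .
qed

lemma bern_mean_cong: "(\<And>T. T \<subseteq> J \<Longrightarrow> f T = g T) \<Longrightarrow> bern_mean l J f = bern_mean l J g"
  by (auto simp: bern_mean_def intro!: sum.cong)

text \<open>The pairs are disjoint, hence independent, and two independent entries agree with
  probability \<open>l^2 + (1 - l)^2\<close>. The induction exposes the last pair, of which only the
  two equal outcomes survive.\<close>

lemma bern_mean_all_agree:
  assumes "inj_on i {..<h}" "inj_on j {..<h}" "i ` {..<h} \<inter> j ` {..<h} = {}"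
  shows "bern_mean l (i ` {..<h} \<union> j ` {..<h}) (\<lambda>T. of_bool (\<forall>m<h. i m \<in> T \<longleftrightarrow> j m \<in> T)) = (l\<^sup>2 + (1 - l)\<^sup>2) ^ h"
  using assms
proof (induction h)
  case 0
  then show ?case by simp
next
  case (Suc h)
  let ?J = "i ` {..<h} \<union> j ` {..<h}"
  let ?f = "\<lambda>h T. of_bool (\<forall>m<h. i m \<in> T \<longleftrightarrow> j m \<in> T) :: real"
  have J: "i ` {..<Suc h} \<union> j ` {..<Suc h} = insert (i h) (insert (j h) ?J)" by (auto simp: lessThan_Suc)
  have new: "i h \<noteq> j h" "i h \<notin> ?J" "j h \<notin> ?J"
    using Suc.prems by (auto simp: lessThan_Suc)
  have neq: "i m \<noteq> i h" "i m \<noteq> j h" "j m \<noteq> i h" "j m \<noteq> j h" if "m < h" for m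
    using new that by (metis UnI1 UnI2 image_eqI lessThan_iff)+
  have IH: "bern_mean l ?J (?f h) = (l\<^sup>2 + (1 - l)\<^sup>2) ^ h"
    using Suc by (auto simp: lessThan_Suc)
  have 1: "bern_mean l ?J (\<lambda>T. ?f (Suc h) (insert (i h) (insert (j h) T))) = bern_mean l ?J (?f h)"
    by (rule bern_mean_cong) (auto simp: less_Suc_eq neq)
  have 2: "bern_mean l ?J (\<lambda>T. ?f (Suc h) (insert (i h) T)) = bern_mean l ?J (\<lambda>_. 0)"
    by (rule bern_mean_cong) (use new in \<open>auto simp: less_Suc_eq\<close>)
  have 3: "bern_mean l ?J (\<lambda>T. ?f (Suc h) (insert (j h) T)) = bern_mean l ?J (\<lambda>_. 0)"
    by (rule bern_mean_cong) (use new in \<open>auto simp: less_Suc_eq\<close>)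
  have 4: "bern_mean l ?J (?f (Suc h)) = bern_mean l ?J (?f h)"
    by (rule bern_mean_cong) (use new in \<open>auto simp: less_Suc_eq\<close>)
  have ins: "bern_mean l (insert x (insert y I)) F =
      l * (l * bern_mean l I (\<lambda>T. F (insert x (insert y T))) + (1 - l) * bern_mean l I (\<lambda>T. F (insert x T))) +
      (1 - l) * (l * bern_mean l I (\<lambda>T. F (insert y T)) + (1 - l) * bern_mean l I F)"
    if "finite I" "x \<noteq> y" "x \<notin> I" "y \<notin> I" for x y :: 'a and I F
    by (simp add: bern_mean_insert that)
  have "bern_mean l (insert (i h) (insert (j h) ?J)) (?f (Suc h)) =
      l * (l * bern_mean l ?J (?f h) + (1 - l) * bern_mean l ?J (\<lambda>_. 0)) +
      (1 - l) * (l * bern_mean l ?J (\<lambda>_. 0) + (1 - l) * bern_mean l ?J (?f h))"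
    by (subst ins[OF _ new]) (simp, simp only: 1 2 3 4)
  also have "\<dots> = (l\<^sup>2 + (1 - l)\<^sup>2) ^ Suc h"
    unfolding IH by (simp add: bern_mean_const power2_eq_square algebra_simps)
  finally show ?case unfolding J .
qed

lemma card_Collect_eq_sum_of_bool: "finite S \<Longrightarrow> (\<Sum>k\<in>S. of_bool (P k)) = real (card {k \<in> S. P k})"
  by (simp add: of_bool_def sum.If_cases Int_def)

text \<open>The common scheme of the three events: a failure forces one of at most
  \<open>4 * n ^ m\<close> deviations, each involving \<open>k\<close> rows, and the Chernoff bound
  applies to every one. The factor 4 leaves room for two Boolean flags in the index. The parameter
  \<open>y\<close> later stands for the set \<open>S\<close>; the threshold on \<open>n\<close> does
  not depend on it, so the bound can be summed over a whole family of sets.\<close>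

lemma eventually_card_events_le:
  fixes l t :: real and I :: "nat \<Rightarrow> 'i set" and J :: "'i \<Rightarrow> nat set" and f :: "'i \<Rightarrow> nat set \<Rightarrow> real"
    and S :: "nat \<Rightarrow> 'y \<Rightarrow> 'i \<Rightarrow> nat set" and B :: "nat \<Rightarrow> nat \<Rightarrow> 'y \<Rightarrow> int mat set"
  assumes l: "0 < l" "l \<le> 1 / 2" and t: "0 < t" "t \<le> 1"
    and I: "\<And>n. finite (I n)" "\<And>n. card (I n) \<le> 4 * n ^ m"
    and J: "\<And>n x. x \<in> I n \<Longrightarrow> J x \<subseteq> {..<n} \<and> card (J x) = k"
    and f: "\<And>n x T. x \<in> I n \<Longrightarrow> \<bar>f x T\<bar> \<le> 1" "\<And>n x. x \<in> I n \<Longrightarrow> bern_mean l (J x) (f x) = 0"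
    and S: "\<And>n y x. P n y \<Longrightarrow> S n y x \<subseteq> {..<n}"
    and B: "\<And>n d y. B n d y \<subseteq> reg_mats n d"
      "\<And>n d y A. n \<ge> n0 \<Longrightarrow> P n y \<Longrightarrow> A \<in> reg_mats n d \<Longrightarrow> A \<in> B n d y \<Longrightarrow>
         \<exists>x\<in>I n. 2 * t * real n \<le> (\<Sum>j\<in>S n y x. f x (pattern A (J x) j))"
  shows "\<exists>c>(0::real). \<forall>\<^sub>F n in sequentially. \<forall>d y. real d = l * real n \<longrightarrow> P n y \<longrightarrow>
    real (card (B n d y)) \<le> exp (- (c * real n)) * real (card (reg_mats n d))"
proof (intro exI conjI)
  define b where "b n = exp (50 * (real k)\<^sup>2 / l) * (real n + 1) ^ k * exp (- (t\<^sup>2 * n))" for n :: nat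
  \<comment> \<open>Half of the exponent \<open>t^2\<close> is given up to absorb the polynomial
    factor and the constant.\<close>
  show "0 < t\<^sup>2 / 2" using t by simp
  have "\<forall>\<^sub>F n in sequentially. (4 * exp (50 * (real k)\<^sup>2 / l)) * (real n + 1) ^ (m + k) * exp (- (t\<^sup>2 * n)) \<le> exp (- (t\<^sup>2 / 2 * n))"
    using t by (intro poly_exp_decay) auto
  moreover have "\<forall>\<^sub>F n in sequentially. 50 * real k + 1 \<le> l * real n"
    using l by real_asymp
  ultimately show "\<forall>\<^sub>F n in sequentially. \<forall>d y. real d = l * real n \<longrightarrow> P n y \<longrightarrow>
    real (card (B n d y)) \<le> exp (- (t\<^sup>2 / 2 * real n)) * real (card (reg_mats n d))"
    using eventually_ge_at_top[of n0]
  proof eventually_elim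
    case (elim n)
    show ?case
    proof (intro allI impI)
      fix d y assume d: "real d = l * real n" and P: "P n y"
      have "50 * real k + 1 \<le> real d" using elim(2) unfolding d .
      then have dn: "50 * k \<le> d" "0 < d" by linarith+
      have "card (B n d y) \<le> card (I n) * (b n * card (reg_mats n d))"
      proof (rule card_Union_le_mult[OF I(1)])
        show "B n d y \<subseteq> (\<Union>x\<in>I n. {A \<in> reg_mats n d. 2 * t * n \<le> (\<Sum>j\<in>S n y x. f x (pattern A (J x) j))})"
        proof
          fix A assume A: "A \<in> B n d y"
          then have "A \<in> reg_mats n d" using B(1) by blast
          with B(2)[OF elim(3) P this A] show "A \<in> (\<Union>x\<in>I n. {A \<in> reg_mats n d. 2 * t * n \<le> (\<Sum>j\<in>S n y x. f x (pattern A (J x) j))})"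
            by simp
        qed
        show "card {A \<in> reg_mats n d. 2 * t * n \<le> (\<Sum>j\<in>S n y x. f x (pattern A (J x) j))} \<le> b n * card (reg_mats n d)"
          if "x \<in> I n" for x
          unfolding b_def
          by (rule reg_mats_chernoff[OF l d dn conjunct1[OF J[OF that]] conjunct2[OF J[OF that]]
                f(1)[OF that] f(2)[OF that] S[OF P]]) (use t in auto)
      qed (use finite_reg_mats in auto)
      also have "\<dots> \<le> (4 * (real n + 1) ^ m) * (b n * card (reg_mats n d))"
      proof (rule mult_right_mono)
        have "real (card (I n)) \<le> real (4 * n ^ m)" using I(2) by (rule of_nat_mono)
        also have "\<dots> \<le> 4 * (real n + 1) ^ m" by (auto intro: power_mono)
        finally show "real (card (I n)) \<le> 4 * (real n + 1) ^ m" .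
      qed (simp add: b_def)
      also have "\<dots> = ((4 * exp (50 * (real k)\<^sup>2 / l)) * (real n + 1) ^ (m + k) * exp (- (t\<^sup>2 * n))) * card (reg_mats n d)"
        unfolding b_def power_add by simp
      also have "\<dots> \<le> exp (- (t\<^sup>2 / 2 * n)) * card (reg_mats n d)"
        by (rule mult_right_mono[OF elim(1)]) simp
      finally show "card (B n d y) \<le> exp (- (t\<^sup>2 / 2 * n)) * card (reg_mats n d)" .
    qed
  qed
qed

lemma switch_set_iff_pattern:
  assumes A: "A \<in> reg_mats n d" and "i < n" "j < n" "k < n" "i \<in> J" "j \<in> J"
  shows "k \<in> switch_set A i j \<longleftrightarrow> (i \<in> pattern A J k) \<noteq> (j \<in> pattern A J k)"
proof -
  have "dim_col A = n" using A by (auto simp: reg_mats_def)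
  then show ?thesis
    using reg_mats_entry[OF A, of i k] reg_mats_entry[OF A, of j k] assms by (auto simp: switch_set_def pattern_def)
qed

text \<open>The intersection consists of the columns in which all \<open>h\<close> pairs agree,
  which has probability \<open>q\<close> under independent entries. Exceeding
  \<open>2 * q * n\<close> is a deviation by \<open>q * n\<close>, whence
  \<open>t = q / 2\<close>.\<close>

lemma eventually_event_Q:
  fixes l :: real
  assumes l: "0 < l" "l \<le> 1 / 2" and h: "0 < h"
  shows "\<exists>c>(0::real). \<forall>\<^sub>F n in sequentially. \<forall>d. real d = l * real n \<longrightarrow>
    real (card (reg_mats n d - event_Q l n d h)) \<le> exp (- (c * real n)) * real (card (reg_mats n d))"
proof -
  define q where "q = (l\<^sup>2 + (1 - l)\<^sup>2) ^ h"
  have "0 < l\<^sup>2 + (1 - l)\<^sup>2" using l by (simp add: add_pos_nonneg)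
  moreover have "l\<^sup>2 + (1 - l)\<^sup>2 \<le> 1" using l mult_nonneg_nonneg[of l "1 - l"]
    by (simp add: power2_eq_square algebra_simps)
  ultimately have q: "0 < q" "q \<le> 1" by (auto simp: q_def intro: power_le_one)
  then have t: "0 < q / 2" "q / 2 \<le> 1" by auto
  \<comment> \<open>Extensional functions keep the index set finite, with at most
    \<open>n ^ (2 * h)\<close> pairs of tuples.\<close>
  define P where "P n = ({..<h} \<rightarrow>\<^sub>E {..<n :: nat}) \<times> ({..<h} \<rightarrow>\<^sub>E {..<n})" for n
  define I where "I n = {(i, j) \<in> P n. inj_on i {..<h} \<and> inj_on j {..<h} \<and> i ` {..<h} \<inter> j ` {..<h} = {}}" for n
  define J where "J = (\<lambda>(i :: nat \<Rightarrow> nat, j :: nat \<Rightarrow> nat). i ` {..<h} \<union> j ` {..<h})"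
  define f where "f = (\<lambda>(i :: nat \<Rightarrow> nat, j) T. of_bool (\<forall>m<h. i m \<in> T \<longleftrightarrow> j m \<in> T) + (- q))"
  have "\<exists>c>(0::real). \<forall>\<^sub>F n in sequentially. \<forall>d (y :: unit). real d = l * real n \<longrightarrow> True \<longrightarrow>
    real (card (reg_mats n d - event_Q l n d h)) \<le> exp (- (c * real n)) * real (card (reg_mats n d))"
  proof (rule eventually_card_events_le[OF l t, where P = "\<lambda>_ _. True" and I = I and J = J and f = f
        and S = "\<lambda>n _ _. {..<n}" and m = "2 * h" and k = "2 * h" and ?n0.0 = 0])
    fix n
    have P: "finite (P n)" by (auto simp: P_def intro: finite_PiE)
    then show "finite (I n)" by (auto simp: I_def intro: finite_subset)
    have "card (I n) \<le> card (P n)" using P by (intro card_mono) (auto simp: I_def)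
    also have "\<dots> = n ^ (2 * h)" by (simp add: P_def card_PiE card_cartesian_product mult_2 power_add)
    finally show "card (I n) \<le> 4 * n ^ (2 * h)" by simp
  next
    fix n x assume "x \<in> I n"
    then obtain i j where x: "x = (i, j)" and ij: "(i, j) \<in> P n"
      and g: "inj_on i {..<h}" "inj_on j {..<h}" "i ` {..<h} \<inter> j ` {..<h} = {}" by (auto simp: I_def)
    have fJ: "finite (J x)" "card (J x) = 2 * h" "J x \<subseteq> {..<n}" using g ij
      by (auto simp: x J_def card_Un_disjoint card_image P_def PiE_iff)
    then show "J x \<subseteq> {..<n} \<and> card (J x) = 2 * h" by simp
    show "bern_mean l (J x) (f x) = 0"
      unfolding x f_def prod.case bern_mean_add
      using bern_mean_all_agree[OF g, of l] bern_mean_const[OF fJ(1)] by (simp add: x J_def q_def)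
    show "\<bar>f x T\<bar> \<le> 1" for T using q by (auto simp: f_def x)
  next
    fix n d A assume Ar: "A \<in> reg_mats n d" and "A \<in> reg_mats n d - event_Q l n d h"
    then obtain i j :: "nat \<Rightarrow> nat" where ij: "i ` {..<h} \<subseteq> {..<n}" "j ` {..<h} \<subseteq> {..<n}"
      "inj_on i {..<h}" "inj_on j {..<h}" "i ` {..<h} \<inter> j ` {..<h} = {}"
      and big: "2 * q * n < card (\<Inter>k\<in>{..<h}. {..<n} - switch_set A (i k) (j k))"
      by (auto simp: event_Q_def q_def not_le)
    define x where "x = (restrict i {..<h}, restrict j {..<h})"
    have x: "x \<in> I n" using ij by (simp add: x_def I_def P_def inj_on_restrict_eq PiE_iff image_subset_iff)
    have ij': "i m < n" "j m < n" "i m \<in> J x" "j m \<in> J x" if "m < h" for m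
      using ij(1,2) that by (auto simp: J_def x_def)
    \<comment> \<open>Positivity of \<open>h\<close> matters: over no indices the intersection would
      be the whole type.\<close>
    have "(\<Inter>k\<in>{..<h}. {..<n} - switch_set A (i k) (j k))
      = {k \<in> {..<n}. \<forall>m<h. i m \<in> pattern A (J x) k \<longleftrightarrow> j m \<in> pattern A (J x) k}"
      using h ij' by (auto simp: switch_set_iff_pattern[OF Ar, where J = "J x"])
    then have "2 * q * n < (\<Sum>k<n. of_bool (\<forall>m<h. i m \<in> pattern A (J x) k \<longleftrightarrow> j m \<in> pattern A (J x) k))"
      using big by (subst card_Collect_eq_sum_of_bool) simp_all
    also have "\<dots> = (\<Sum>k<n. f x (pattern A (J x) k) + q)"
      by (intro sum.cong refl) (auto simp: f_def x_def)
    finally have "2 * (q / 2) * n \<le> (\<Sum>k<n. f x (pattern A (J x) k))"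
      by (simp add: sum.distrib)
    then show "\<exists>x\<in>I n. 2 * (q / 2) * real n \<le> (\<Sum>j<n. f x (pattern A (J x) j))"
      using x by auto
  qed auto
  then show ?thesis by simp
qed

text \<open>Both pairs differ in a column with probability \<open>u\<close>, so the expected size on
  either side is about \<open>u * n / 2\<close>, and a size below \<open>u * n / 4\<close> is a
  deviation. The flag \<open>b\<close> in the index records the side on which it occurs.\<close>

lemma eventually_event_Q':
  fixes l :: real
  assumes l: "0 < l" "l \<le> 1 / 2"
  shows "\<exists>c>(0::real). \<forall>\<^sub>F n in sequentially. \<forall>d S. real d = l * real n \<longrightarrow> S \<subseteq> {..<n} \<and> card S = n div 2 \<longrightarrow>
    real (card (reg_mats n d - event_Q' l n d S)) \<le> exp (- (c * real n)) * real (card (reg_mats n d))"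
proof -
  define u where "u = (2 * l * (1 - l))\<^sup>2"
  have "0 < 2 * l * (1 - l)" using l by simp
  moreover have "2 * l * (1 - l) \<le> 1"
  proof -
    have "2 * l * (1 - l) \<le> 1 * 1" using l by (intro mult_mono) auto
    then show ?thesis by simp
  qed
  ultimately have u: "0 < u" "u \<le> 1" by (auto simp: u_def power_le_one)
  then have t: "0 < u / 16" "u / 16 \<le> 1" by auto
  define P where "P n = {..<n :: nat} \<times> {..<n} \<times> {..<n} \<times> {..<n} \<times> (UNIV :: bool set)" for n
  define I where "I n = {(i1, i2, j1, j2, b) \<in> P n. distinct [i1, i2, j1, j2]}" for n
  define J where "J = (\<lambda>(i1 :: nat, i2 :: nat, j1 :: nat, j2 :: nat, b :: bool). {i1, i2, j1, j2})"
  define f where "f = (\<lambda>(i1 :: nat, i2 :: nat, j1 :: nat, j2 :: nat, b :: bool) T.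
       u - of_bool ((i1 \<in> T) \<noteq> (j1 \<in> T) \<and> (i2 \<in> T) \<noteq> (j2 \<in> T)))"
  define Y where "Y n S = (\<lambda>(i1 :: nat, i2 :: nat, j1 :: nat, j2 :: nat, b). if b then S else {..<n :: nat} - S)" for n S
  show ?thesis
  proof (rule eventually_card_events_le[OF l t, where P = "\<lambda>n S. S \<subseteq> {..<n} \<and> card S = n div 2"
        and I = I and J = J and f = f and S = Y and m = 4 and k = 4 and ?n0.0 = 4])
    fix n
    have P: "finite (P n)" by (auto simp: P_def)
    then show "finite (I n)" by (auto simp: I_def intro: finite_subset)
    have "card (I n) \<le> card (P n)" using P by (intro card_mono) (auto simp: I_def)
    also have "\<dots> = 2 * n ^ 4" by (simp add: P_def card_cartesian_product power4_eq_xxxx)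
    finally show "card (I n) \<le> 4 * n ^ 4" by simp
  next
    fix n x assume "x \<in> I n"
    then obtain i1 i2 j1 j2 b where x: "x = (i1, i2, j1, j2, b)" and dist: "distinct [i1, i2, j1, j2]"
      and lt: "i1 < n" "i2 < n" "j1 < n" "j2 < n" by (auto simp: I_def P_def)
    have "bern_mean l {i1, i2, j1, j2} (f x) = 0"
      using dist by (simp add: x f_def bern_mean_insert u_def) (simp add: power2_eq_square algebra_simps)
    then show "bern_mean l (J x) (f x) = 0" by (simp add: x J_def)
    show "\<bar>f x T\<bar> \<le> 1" for T using u by (auto simp: f_def x)
    show "J x \<subseteq> {..<n} \<and> card (J x) = 4" using dist lt by (auto simp: x J_def)
  next
    fix n d S A
    assume n: "4 \<le> n" and S: "S \<subseteq> {..<n} \<and> card S = n div 2" and Ar: "A \<in> reg_mats n d"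
      and A: "A \<in> reg_mats n d - event_Q' l n d S"
    have fS: "finite S" using S finite_subset by blast
    from A obtain i1 i2 j1 j2 where lt: "i1 < n" "i2 < n" "j1 < n" "j2 < n" and dist: "distinct [i1, i2, j1, j2]"
      and small: "min (card (switch_set A i1 j1 \<inter> switch_set A i2 j2 \<inter> S))
           (card (switch_set A i1 j1 \<inter> switch_set A i2 j2 \<inter> ({..<n} - S))) < u * n / 4"
      by (auto simp: event_Q'_def u_def not_le)
    define b where "b \<longleftrightarrow> card (switch_set A i1 j1 \<inter> switch_set A i2 j2 \<inter> S) < u * n / 4"
    define x where "x = (i1, i2, j1, j2, b)"
    have x: "x \<in> I n" using lt dist by (simp add: x_def I_def P_def)
    have Y: "Y n S x \<subseteq> {..<n}" "finite (Y n S x)" using S fS by (auto simp: Y_def x_def)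
    have "card ({..<n} - S) = n - n div 2" using S fS by (subst card_Diff_subset) auto
    then have cY: "real n / 2 - 1 / 2 \<le> card (Y n S x)" using S by (auto simp: Y_def x_def)
    have "card (switch_set A i1 j1 \<inter> switch_set A i2 j2 \<inter> Y n S x) \<le> u * n / 4"
      using small by (auto simp: Y_def x_def b_def min_def split: if_splits)
    also have "switch_set A i1 j1 \<inter> switch_set A i2 j2 \<inter> Y n S x
       = {k \<in> Y n S x. (i1 \<in> pattern A (J x) k) \<noteq> (j1 \<in> pattern A (J x) k) \<and> (i2 \<in> pattern A (J x) k) \<noteq> (j2 \<in> pattern A (J x) k)}"
      using Y lt by (auto simp: J_def x_def switch_set_iff_pattern[OF Ar, where J = "{i1, i2, j1, j2}"])
    finally have "(\<Sum>k\<in>Y n S x. of_bool ((i1 \<in> pattern A (J x) k) \<noteq> (j1 \<in> pattern A (J x) k) \<and> (i2 \<in> pattern A (J x) k) \<noteq> (j2 \<in> pattern A (J x) k))) \<le> u * n / 4"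
      using Y by (subst card_Collect_eq_sum_of_bool) simp_all
    then have "(\<Sum>k\<in>Y n S x. f x (pattern A (J x) k)) \<ge> u * card (Y n S x) - u * n / 4"
      unfolding f_def x_def by (simp add: sum_subtractf)
    moreover have "u * (real n / 2 - 1 / 2) \<le> u * card (Y n S x)" using cY u by (intro mult_left_mono) auto
    \<comment> \<open>The left side is \<open>u * n / 8\<close>; given the rounding loss
      \<open>u / 2\<close>, this holds exactly from \<open>n = 4\<close> on.\<close>
    moreover have "2 * (u / 16) * n \<le> u * (real n / 2 - 1 / 2) - u * n / 4"
      using mult_left_mono[of 4 "real n" u] n u by (simp add: field_simps)
    ultimately have "2 * (u / 16) * n \<le> (\<Sum>k\<in>Y n S x. f x (pattern A (J x) k))" by linarith
    then show "\<exists>x\<in>I n. 2 * (u / 16) * real n \<le> (\<Sum>j\<in>Y n S x. f x (pattern A (J x) j))"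
      using x Ar by auto
  qed (auto simp: Y_def split: if_splits)
qed

text \<open>Either the switching set has fewer than \<open>u * n / 4\<close> elements on one side,
  far below its mean, or the absolute value of \<open>omega\<close>, which has mean 0 under
  independent entries, exceeds a sixth of \<open>u * n / 4\<close>. The latter is
  \<open>2 * (u / 48) * n\<close> and fixes \<open>t\<close>.\<close>

lemma eventually_event_Q'':
  fixes l :: real
  assumes l: "0 < l" "l \<le> 1 / 2"
  shows "\<exists>c>(0::real). \<forall>\<^sub>F n in sequentially. \<forall>d S. real d = l * real n \<longrightarrow> S \<subseteq> {..<n} \<and> card S = n div 2 \<longrightarrow>
    real (card (reg_mats n d - event_Q'' n d S)) \<le> exp (- (c * real n)) * real (card (reg_mats n d))"
proof -
  define u where "u = 2 * l * (1 - l)"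
  have "2 * l * (1 - l) \<le> 1 * 1" using l by (intro mult_mono) auto
  then have u: "0 < u" "u \<le> 1" using l by (auto simp: u_def)
  then have t: "0 < u / 48" "u / 48 \<le> 1" by auto
  define P where "P n = {..<n :: nat} \<times> {..<n} \<times> (UNIV :: bool set) \<times> (UNIV :: bool set)" for n
  define I where "I n = {(i, j, a, b) \<in> P n. i \<noteq> j}" for n
  define J where "J = (\<lambda>(i :: nat, j :: nat, a :: bool, b :: bool). {i, j})"
    \<comment> \<open>The flag \<open>a\<close> selects between the deviations of \<open>\<omega>\<close> (whose sign is absorbed by swapping
    \<open>i\<close> and \<open>j\<close>) and those of the switching set; \<open>b\<close> chooses between \<open>S\<close> and its complement.\<close>
  define f :: "nat \<times> nat \<times> bool \<times> bool \<Rightarrow> nat set \<Rightarrow> real" where "f = (\<lambda>(i, j, a, b) T.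
       if a then of_bool (i \<in> T) - of_bool (j \<in> T) else u - of_bool ((i \<in> T) \<noteq> (j \<in> T)))"
  define Y where "Y n S = (\<lambda>(i :: nat, j :: nat, a :: bool, b). if b then S else {..<n :: nat} - S)" for n S
  show ?thesis
  proof (rule eventually_card_events_le[OF l t, where P = "\<lambda>n S. S \<subseteq> {..<n} \<and> card S = n div 2"
        and I = I and J = J and f = f and S = Y and m = 2 and k = 2 and ?n0.0 = 4])
    fix n
    have P: "finite (P n)" by (auto simp: P_def)
    then show "finite (I n)" by (auto simp: I_def intro: finite_subset)
    have "card (I n) \<le> card (P n)" using P by (intro card_mono) (auto simp: I_def)
    also have "\<dots> = 4 * n ^ 2" by (simp add: P_def card_cartesian_product power2_eq_square)
    finally show "card (I n) \<le> 4 * n ^ 2" by simp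
  next
    fix n x assume "x \<in> I n"
    then obtain i j a b where x: "x = (i, j, a, b)" and dist: "i \<noteq> j"
      and lt: "i < n" "j < n" by (auto simp: I_def P_def)
    have "bern_mean l {i, j} (f x) = 0"
      using dist by (cases a) (simp_all add: x f_def bern_mean_insert u_def algebra_simps)
    then show "bern_mean l (J x) (f x) = 0" by (simp add: x J_def)
    show "\<bar>f x T\<bar> \<le> 1" for T using u by (auto simp: f_def x)
    show "J x \<subseteq> {..<n} \<and> card (J x) = 2" using dist lt by (auto simp: x J_def)
  next
    fix n d S A
    assume n: "4 \<le> n" and S: "S \<subseteq> {..<n} \<and> card S = n div 2" and Ar: "A \<in> reg_mats n d"
      and A: "A \<in> reg_mats n d - event_Q'' n d S"
    have fS: "finite S" using S finite_subset by blast
    from A obtain i j where lt: "i < n" "j < n" and dist: "i \<noteq> j"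
      and big: "min (real (card (S \<inter> switch_set A i j)) / 6) (real (card (({..<n} - S) \<inter> switch_set A i j)) / 6)
        < real_of_int \<bar>omega A i j S\<bar>"
      by (auto simp: event_Q''_def not_le)
    have om: "real_of_int (omega A i' j' S) = (\<Sum>k\<in>S. f (i', j', True, True) (pattern A {i', j'} k))"
      if "i' < n" "j' < n" for i' j'
    proof -
      have "real_of_int (A $$ (i', k) - A $$ (j', k)) = f (i', j', True, True) (pattern A {i', j'} k)" if "k \<in> S" for k
        using reg_mats_entry[OF Ar \<open>i' < n\<close>, of k] reg_mats_entry[OF Ar \<open>j' < n\<close>, of k] S that
        by (auto simp: f_def pattern_def)
      then show ?thesis unfolding omega_def of_int_sum by (intro sum.cong refl)
    qed
    have omsym: "omega A j i S = - omega A i j S" by (simp add: omega_def sum_negf[symmetric])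
    have sw: "u * card (Y n S (i, j, False, b)) - card (Y n S (i, j, False, b) \<inter> switch_set A i j) =
       (\<Sum>k\<in>Y n S (i, j, False, b). f (i, j, False, b) (pattern A {i, j} k))" for b
    proof -
      have Y: "Y n S (i, j, False, b) \<subseteq> {..<n}" "finite (Y n S (i, j, False, b))" using S fS by (auto simp: Y_def)
      have "Y n S (i, j, False, b) \<inter> switch_set A i j = {k \<in> Y n S (i, j, False, b). (i \<in> pattern A {i, j} k) \<noteq> (j \<in> pattern A {i, j} k)}"
        using Y lt by (auto simp: switch_set_iff_pattern[OF Ar, where J = "{i, j}"])
      then show ?thesis using card_Collect_eq_sum_of_bool[OF Y(2), of "\<lambda>k. (i \<in> pattern A {i, j} k) \<noteq> (j \<in> pattern A {i, j} k)"]
        by (simp add: f_def sum_subtractf)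
    qed
    have "card ({..<n} - S) = n - n div 2" using S fS by (subst card_Diff_subset) auto
    then have cY: "real n / 2 - 1 / 2 \<le> card (Y n S (i, j, False, b))" for b using S by (auto simp: Y_def)
    have "\<exists>x\<in>I n. 2 * (u / 48) * real n \<le> (\<Sum>k\<in>Y n S x. f x (pattern A (J x) k))"
    proof (cases "\<exists>b. card (Y n S (i, j, False, b) \<inter> switch_set A i j) < u * n / 4")
      case True
      then obtain b where b: "card (Y n S (i, j, False, b) \<inter> switch_set A i j) < u * n / 4" by blast
      have "u * (real n / 2 - 1 / 2) \<le> u * card (Y n S (i, j, False, b))" using cY u by (intro mult_left_mono) auto
      moreover have "2 * (u / 48) * n \<le> u * (real n / 2 - 1 / 2) - u * n / 4"
        using mult_left_mono[of 4 "real n" u] n u by (simp add: field_simps)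
      ultimately have "2 * (u / 48) * n \<le> (\<Sum>k\<in>Y n S (i, j, False, b). f (i, j, False, b) (pattern A {i, j} k))"
        using b unfolding sw[symmetric] by linarith
      then show ?thesis using lt dist by (intro bexI[of _ "(i, j, False, b)"]) (auto simp: I_def P_def J_def)
    next
      case False
      from False[unfolded not_ex, THEN spec, of True] False[unfolded not_ex, THEN spec, of False]
      have "u * n / 4 \<le> card (S \<inter> switch_set A i j)" "u * n / 4 \<le> card (({..<n} - S) \<inter> switch_set A i j)"
        by (simp_all add: Y_def not_less)
      then have "2 * (u / 48) * n \<le> real_of_int \<bar>omega A i j S\<bar>" using big by linarith
      then have "2 * (u / 48) * n \<le> real_of_int (omega A i j S) \<or> 2 * (u / 48) * n \<le> real_of_int (omega A j i S)"
        unfolding omsym by linarith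
      then show ?thesis
      proof
        assume "2 * (u / 48) * n \<le> real_of_int (omega A i j S)"
        then show ?thesis unfolding om[OF lt]
          using lt dist by (intro bexI[of _ "(i, j, True, True)"]) (auto simp: I_def P_def J_def Y_def)
      next
        assume "2 * (u / 48) * n \<le> real_of_int (omega A j i S)"
        then show ?thesis unfolding om[OF lt(2,1)]
          using lt dist by (intro bexI[of _ "(j, i, True, True)"]) (auto simp: I_def P_def J_def Y_def)
      qed
    qed
    then show "\<exists>x\<in>I n. 2 * (u / 48) * real n \<le> (\<Sum>j\<in>Y n S x. f x (pattern A (J x) j))"
      using Ar by auto
  qed (auto simp: Y_def split: if_splits)
qed

section \<open>Union bound over the family of sets and small dimensions\<close>

theorem theorem2p17:
  "\<exists>C>0. \<forall>(l::real) (h::nat). 0 < l \<and> l \<le> 1/2 \<and> 0 < h \<longrightarrow>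
     (\<exists>c>0. \<forall>(n::nat) (d::nat) (R :: nat set set).
        real d = l * real n \<and> real h < real n powr (1/4) \<and>
        R \<subseteq> {S. S \<subseteq> {..<n} \<and> card S = n div 2} \<and> R \<noteq> {} \<longrightarrow>
        measure_pmf.prob (pmf_of_set (reg_mats n d)) (reg_mats n d - event_QR l n d h R)
          \<le> C * real (card R) * exp (- (c * real n)))"
proof (rule exI[of _ 3], intro conjI allI impI)
  fix l :: real and h :: nat
  assume "0 < l \<and> l \<le> 1/2 \<and> 0 < h"
  then have l: "0 < l" "l \<le> 1 / 2" and h: "0 < h" by auto
  let ?M = "\<lambda>n d. real (card (reg_mats n d))"
  obtain c1 where c1: "c1 > 0" and ev1: "\<forall>\<^sub>F n in sequentially. \<forall>d. real d = l * real n \<longrightarrow>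
      real (card (reg_mats n d - event_Q l n d h)) \<le> exp (- (c1 * real n)) * ?M n d"
    using eventually_event_Q[OF l h] by auto
  obtain c2 where c2: "c2 > 0" and ev2: "\<forall>\<^sub>F n in sequentially. \<forall>d S. real d = l * real n \<longrightarrow> S \<subseteq> {..<n} \<and> card S = n div 2 \<longrightarrow>
      real (card (reg_mats n d - event_Q' l n d S)) \<le> exp (- (c2 * real n)) * ?M n d"
    using eventually_event_Q'[OF l] by auto
  obtain c3 where c3: "c3 > 0" and ev3: "\<forall>\<^sub>F n in sequentially. \<forall>d S. real d = l * real n \<longrightarrow> S \<subseteq> {..<n} \<and> card S = n div 2 \<longrightarrow>
      real (card (reg_mats n d - event_Q'' n d S)) \<le> exp (- (c3 * real n)) * ?M n d"
    using eventually_event_Q''[OF l] by auto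
  from ev1 obtain N1 where N1: "\<And>n d. n \<ge> N1 \<Longrightarrow> real d = l * real n \<Longrightarrow>
      real (card (reg_mats n d - event_Q l n d h)) \<le> exp (- (c1 * real n)) * ?M n d"
    unfolding eventually_sequentially by blast
  from ev2 obtain N2 where N2: "\<And>n d S. n \<ge> N2 \<Longrightarrow> real d = l * real n \<Longrightarrow> S \<subseteq> {..<n} \<and> card S = n div 2 \<Longrightarrow>
      real (card (reg_mats n d - event_Q' l n d S)) \<le> exp (- (c2 * real n)) * ?M n d"
    unfolding eventually_sequentially by blast
  from ev3 obtain N3 where N3: "\<And>n d S. n \<ge> N3 \<Longrightarrow> real d = l * real n \<Longrightarrow> S \<subseteq> {..<n} \<and> card S = n div 2 \<Longrightarrow>
      real (card (reg_mats n d - event_Q'' n d S)) \<le> exp (- (c3 * real n)) * ?M n d"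
    unfolding eventually_sequentially by blast
  define N where "N = max N1 (max N2 N3)"
  \<comment> \<open>The term \<open>1 / (N + 1)\<close> keeps \<open>c * n \<le> 1\<close> for
    \<open>n < N\<close>, where the claimed bound is at least \<open>3 / exp 1 \<ge> 1\<close> and
    hence trivial.\<close>
  define c where "c = min (min c1 c2) (min c3 (1 / (real N + 1)))"
  have c: "c > 0" "c \<le> c1" "c \<le> c2" "c \<le> c3" "c \<le> 1 / (real N + 1)" using c1 c2 c3 by (auto simp: c_def)
  show "\<exists>c>0. \<forall>(n::nat) (d::nat) (R :: nat set set).
        real d = l * real n \<and> real h < real n powr (1/4) \<and>
        R \<subseteq> {S. S \<subseteq> {..<n} \<and> card S = n div 2} \<and> R \<noteq> {} \<longrightarrow>
        measure_pmf.prob (pmf_of_set (reg_mats n d)) (reg_mats n d - event_QR l n d h R)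
          \<le> 3 * real (card R) * exp (- (c * real n))"
  proof (intro exI[of _ c] conjI allI impI c(1))
    fix n d :: nat and R :: "nat set set"
    assume "real d = l * real n \<and> real h < real n powr (1/4) \<and>
        R \<subseteq> {S. S \<subseteq> {..<n} \<and> card S = n div 2} \<and> R \<noteq> {}"
    then have d: "real d = l * real n" and R: "R \<subseteq> {S. S \<subseteq> {..<n} \<and> card S = n div 2}" "R \<noteq> {}" by auto
    have fR: "finite R" by (rule finite_subset[of _ "Pow {..<n}"]) (use R in auto)
    then have cR: "1 \<le> real (card R)" using R by (simp add: Suc_le_eq card_gt_0_iff)
    let ?B = "reg_mats n d - event_QR l n d h R" and ?p = "exp (- (c * real n))"
    show "measure_pmf.prob (pmf_of_set (reg_mats n d)) ?B \<le> 3 * real (card R) * ?p"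
    proof (cases "n < N")
      case True
      have "c * real n \<le> 1 / (real N + 1) * (real N + 1)" using c True by (intro mult_mono) auto
      also have "\<dots> = 1" by simp
      finally have "exp (c * real n) \<le> exp 1" by simp
      then have "exp (c * real n) \<le> 3" using exp_le by linarith
      then have "1 \<le> 3 * ?p" by (simp add: exp_minus field_simps)
      also have "\<dots> \<le> 3 * real (card R) * ?p" using cR by (intro mult_right_mono) auto
      finally show ?thesis by (rule order_trans[OF measure_pmf.prob_le_1])
    next
      case False
      then have n: "n \<ge> N1" "n \<ge> N2" "n \<ge> N3" by (auto simp: N_def)
      show ?thesis
      proof (cases "reg_mats n d = {}")
        \<comment> \<open>On the empty set \<open>pmf_of_set\<close> is unspecified, but the bad
          event is then empty and has probability 0.\<close>
        case True
        then show ?thesis by simp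
      next
        case ne: False
        have mono: "exp (- (c' * real n)) * ?M n d \<le> ?p * ?M n d" if "c \<le> c'" for c'
          using that by (intro mult_right_mono) (simp_all add: mult_right_mono)
        have "card ?B \<le> card ((reg_mats n d - event_Q l n d h) \<union>
           (\<Union>S\<in>R. (reg_mats n d - event_Q' l n d S) \<union> (reg_mats n d - event_Q'' n d S)))"
          using finite_reg_mats[of n d] fR by (intro card_mono) (auto simp: event_QR_def)
        also have "\<dots> \<le> card (reg_mats n d - event_Q l n d h) +
           card (\<Union>S\<in>R. (reg_mats n d - event_Q' l n d S) \<union> (reg_mats n d - event_Q'' n d S))"
          by (rule card_Un_le)
        also have "\<dots> \<le> card (reg_mats n d - event_Q l n d h) +
           (\<Sum>S\<in>R. card (reg_mats n d - event_Q' l n d S) + card (reg_mats n d - event_Q'' n d S))"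
          by (intro add_left_mono order_trans[OF card_UN_le[OF fR]] sum_mono card_Un_le)
        finally have "real (card ?B) \<le> real (card (reg_mats n d - event_Q l n d h)) +
           (\<Sum>S\<in>R. real (card (reg_mats n d - event_Q' l n d S)) + real (card (reg_mats n d - event_Q'' n d S)))"
          by (simp flip: of_nat_sum of_nat_add)
        also have "\<dots> \<le> ?p * ?M n d + (\<Sum>S\<in>R. ?p * ?M n d + ?p * ?M n d)"
        proof (intro add_mono sum_mono)
          show "real (card (reg_mats n d - event_Q l n d h)) \<le> ?p * ?M n d"
            by (rule order_trans[OF N1[OF n(1) d] mono[OF c(2)]])
          fix S assume "S \<in> R"
          then have S: "S \<subseteq> {..<n} \<and> card S = n div 2" using R by auto
          show "real (card (reg_mats n d - event_Q' l n d S)) \<le> ?p * ?M n d"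
            by (rule order_trans[OF N2[OF n(2) d S] mono[OF c(3)]])
          show "real (card (reg_mats n d - event_Q'' n d S)) \<le> ?p * ?M n d"
            by (rule order_trans[OF N3[OF n(3) d S] mono[OF c(4)]])
        qed
        also have "\<dots> = (1 + 2 * real (card R)) * (?p * ?M n d)" by (simp add: algebra_simps)
        \<comment> \<open>As \<open>R\<close> is nonempty, the single term from
          \<open>event_Q\<close> is absorbed:
          \<open>1 + 2 * card R \<le> 3 * card R\<close>.\<close>
        also have "\<dots> \<le> (3 * real (card R)) * (?p * ?M n d)" using cR by (intro mult_right_mono) auto
        finally have "real (card ?B) / ?M n d \<le> 3 * real (card R) * ?p"
          using ne finite_reg_mats[of n d] by (simp add: divide_le_eq card_gt_0_iff mult_ac)
        moreover have "reg_mats n d \<inter> ?B = ?B" by blast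
        ultimately show ?thesis using measure_pmf_of_set[OF ne finite_reg_mats, of ?B] by simp
      qed
    qed
  qed
qed simp

end
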